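(* Let $k$ be a field, $G$ a finite group, $X$ a set of representatives of the conjugacy classes of $G$, $x\in X$ and $s\ge0$. Let $\widetilde B_x:\mathrm H_s(C_G(x),k)\to\mathrm H_{s+1}(C_G(x),k)$ be the map induced by the Connes operator $B:\mathrm{HH}_s(kG,kG)\to\mathrm{HH}_{s+1}(kG,kG)$ through the additive decomposition. Then, at the complex level, $\widetilde B_x$ is given by $$\widetilde B_x(\gamma)=(h_s^{-1}\cdots h_1^{-1}x,\,h_{1,s})+\sum_{i=1}^s(-1)^{is}(h_{i,s},\,h_s^{-1}\cdots h_1^{-1}x,\,h_{1,i-1})\in k[\overline{C_G(x)}^{\times(s+1)}]$$ for $\gamma=(h_{1,s})\in k[\overline{C_G(x)}^{\times s}]$.
   Context: Notation. For a group $H$, $\overline H=H\setminus\{1\}$; $g_{i,j}$ denotes the sequence $g_i,\dots,g_j$ (empty if $j<i$). $C_n(kG,kG)=k[G\times\overline G^{\times n}]$ is the normalized Hochschild chain complex, with $\partial_n(g_0,g_{1,n})=(g_0g_1,g_{2,n})+\sum_{i=1}^{n-1}(-1)^i(g_0,g_{1,i-1},g_ig_{i+1},g_{i+2,n})+(-1)^n(g_ng_0,g_{1,n-1})$; tuples with an entry $1$ in one of the $\overline G$-positions are $0$. The Connes operator is $B(g_0,g_{1,s})=\sum_{i=0}^s(-1)^{is}(1,g_{i,s},g_{0,i-1})\in C_{s+1}(kG,kG)$. $C_n(H,k)=k[\overline H^{\times n}]$ is the normalized group chain complex with trivial coefficients (tuples with an entry $1$ are $0$), $\partial_n(h_{1,n})=(h_{2,n})+\sum_{i=1}^{n-1}(-1)^i(h_{1,i-1},h_ih_{i+1},h_{i+2,n})+(-1)^n(h_{1,n-1})$,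 computing $\mathrm H_*(H,k)$. $C_x$ is the conjugacy class and $C_G(x)$ the centralizer of $x$. $\mathcal H_{x,s}=k[(g_s^{-1}\cdots g_1^{-1}u,g_{1,s}):u\in C_x,\ g_i\in\overline G]$; $\mathcal H_{x,*}$ is a subcomplex of $C_*(kG,kG)$, $C_*(kG,kG)=\bigoplus_{x\in X}\mathcal H_{x,*}$, and $B$ restricts to $B_x:\mathcal H_{x,s}\to\mathcal H_{x,s+1}$. The chain map $\iota_x:C_*(C_G(x),k)\to\mathcal H_{x,*}$, $(h_{1,s})\mapsto(h_s^{-1}\cdots h_1^{-1}x,h_{1,s})$ is a homotopy equivalence with homotopy inverse $\rho_x$ defined as follows: fix right coset representatives $\gamma_{1,x}=1,\dots,\gamma_{n_x,x}$ of $C_G(x)$ in $G$; then $\rho_x(g_n^{-1}\cdots g_1^{-1}g_0^{-1}xg_0,g_{1,n})=(h_{i_1},\dots,h_{i_n})$, where $g_0\in C_G(x)\gamma_{i,x}$ and $\gamma_{i,x}g_1=h_{i_1}\gamma_{s_i^1,x}$, $\gamma_{s_i^1,x}g_2=h_{i_2}\gamma_{s_i^2,x}$, ..., $\gamma_{s_i^{n-1},x}g_n=h_{i_n}\gamma_{s_i^n,x}$ with $h_{i_j}\in C_G(x)$. The map $\widetilde B_x$ on homology is the one corresponding to $B_x$ under the isomorphisms $H_*(\mathcal H_{x,*})\simeq\mathrm H_*(C_G(x),k)$ induced by $\rho_x$ (inverse to those induced by $\iota_x$); "at the complex level" means that it is induced by the chain-level map $\rho_x\circ B_x\circ\iota_x$.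 *)

theory Defs
  imports "HOL-Algebra.Coset" "HOL-Library.Poly_Mapping"
begin

section \<open>Free modules and homology\<close>

text \<open>
  The vector space \<open>k[S]\<close> is the set of finitely supported functions \<open>'b \<Rightarrow>\<^sub>0 'k\<close> with support
  in \<open>S\<close>; the basis vector of \<open>t\<close> is \<open>Poly_Mapping.single t 1\<close>.
\<close>

definition free_on :: "'b set \<Rightarrow> ('b \<Rightarrow>\<^sub>0 'k::field) set" where
  "free_on S = {p. Poly_Mapping.keys p \<subseteq> S}"

definition scale :: "'k \<Rightarrow> ('b \<Rightarrow>\<^sub>0 'k::field) \<Rightarrow> ('b \<Rightarrow>\<^sub>0 'k)" where
  "scale a p = Poly_Mapping.map ((*) a) p"

definition lin_ext :: "('b \<Rightarrow> ('c \<Rightarrow>\<^sub>0 'k)) \<Rightarrow> ('b \<Rightarrow>\<^sub>0 'k::field) \<Rightarrow> ('c \<Rightarrow>\<^sub>0 'k)" where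
  "lin_ext f p = (\<Sum>t\<in>Poly_Mapping.keys p. scale (Poly_Mapping.lookup p t) (f t))"

text \<open>
  A complex is given by its chain spaces \<open>C n\<close> and one differential \<open>d\<close> acting on chains of every
  degree (the degree of a chain is read off from the length of its tuples).
\<close>

definition cycles :: "(nat \<Rightarrow> 'c set) \<Rightarrow> ('c \<Rightarrow> 'c::ab_group_add) \<Rightarrow> nat \<Rightarrow> 'c set" where
  "cycles C d n = {z \<in> C n. d z = 0}"

definition boundaries :: "(nat \<Rightarrow> 'c set) \<Rightarrow> ('c \<Rightarrow> 'c::ab_group_add) \<Rightarrow> nat \<Rightarrow> 'c set" where
  "boundaries C d n = d ` C (Suc n)"

definition homologous :: "(nat \<Rightarrow> 'c set) \<Rightarrow> ('c \<Rightarrow> 'c::ab_group_add) \<Rightarrow> nat \<Rightarrow> ('c \<times> 'c) set" where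
  "homologous C d n =
     {(z, w). z \<in> cycles C d n \<and> w \<in> cycles C d n \<and> z - w \<in> boundaries C d n}"

definition homology :: "(nat \<Rightarrow> 'c set) \<Rightarrow> ('c \<Rightarrow> 'c::ab_group_add) \<Rightarrow> nat \<Rightarrow> 'c set set" where
  "homology C d n = cycles C d n // homologous C d n"

definition hclass :: "(nat \<Rightarrow> 'c set) \<Rightarrow> ('c \<Rightarrow> 'c::ab_group_add) \<Rightarrow> nat \<Rightarrow> 'c \<Rightarrow> 'c set" where
  "hclass C d n z = homologous C d n `` {z}"

text \<open>
  The map induced by \<open>f\<close> on homology classes, with target \<open>H\<^sub>n\<close> of the complex \<open>(C, d)\<close>. When \<open>f\<close>
  preserves cycles and boundaries, all members of the union coincide.
\<close>

definition hmap :: "(nat \<Rightarrow> 'c set) \<Rightarrow> ('c \<Rightarrow> 'c::ab_group_add) \<Rightarrow> nat \<Rightarrow> ('b \<Rightarrow> 'c) \<Rightarrow> 'b set \<Rightarrow> 'c set" where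
  "hmap C d n f c = (\<Union>z\<in>c. hclass C d n (f z))"

section \<open>Conjugacy\<close>

definition centralizer :: "('a, 'm) monoid_scheme \<Rightarrow> 'a \<Rightarrow> 'a set" where
  "centralizer G x = {g \<in> carrier G. g \<otimes>\<^bsub>G\<^esub> x = x \<otimes>\<^bsub>G\<^esub> g}"

definition centralizer_group :: "('a, 'm) monoid_scheme \<Rightarrow> 'a \<Rightarrow> ('a, 'm) monoid_scheme" where
  "centralizer_group G x = G\<lparr>carrier := centralizer G x\<rparr>"

definition conj_class :: "('a, 'm) monoid_scheme \<Rightarrow> 'a \<Rightarrow> 'a set" where
  "conj_class G x = {inv\<^bsub>G\<^esub> g \<otimes>\<^bsub>G\<^esub> x \<otimes>\<^bsub>G\<^esub> g | g. g \<in> carrier G}"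

definition conj_class_reps :: "('a, 'm) monoid_scheme \<Rightarrow> 'a set \<Rightarrow> bool" where
  "conj_class_reps G X \<longleftrightarrow>
     X \<subseteq> carrier G \<and> (\<forall>g\<in>carrier G. \<exists>!y. y \<in> X \<and> y \<in> conj_class G g)"

definition right_coset_reps :: "('a, 'm) monoid_scheme \<Rightarrow> 'a set \<Rightarrow> 'a set \<Rightarrow> bool" where
  "right_coset_reps G H T \<longleftrightarrow>
     T \<subseteq> carrier G \<and> (\<forall>R\<in>rcosets\<^bsub>G\<^esub> H. \<exists>!t. t \<in> T \<and> t \<in> R)"

section \<open>Normalized chain complexes\<close>

definition nontriv_tuples :: "('a, 'm) monoid_scheme \<Rightarrow> nat \<Rightarrow> 'a list set" where
  "nontriv_tuples G n = {gs. length gs = n \<and> set gs \<subseteq> carrier G - {\<one>\<^bsub>G\<^esub>}}"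

text \<open>
  \<open>merge G i\<close> replaces the entries \<open>g\<^sub>i, g\<^sub>i\<^sub>+\<^sub>1\<close> of \<open>(g\<^sub>1, \<dots>, g\<^sub>n)\<close> by their product; the entry
  \<open>g\<^sub>i\<close> of the tuple is \<open>gs ! (i - 1)\<close>.
\<close>

definition merge :: "('a, 'm) monoid_scheme \<Rightarrow> nat \<Rightarrow> 'a list \<Rightarrow> 'a list" where
  "merge G i gs = take (i - 1) gs @ [gs ! (i - 1) \<otimes>\<^bsub>G\<^esub> gs ! i] @ drop (i + 1) gs"

subsection \<open>Group chains with trivial coefficients\<close>

definition grp_tuple :: "('a, 'm) monoid_scheme \<Rightarrow> 'a list \<Rightarrow> ('a list \<Rightarrow>\<^sub>0 'k::field)" where
  "grp_tuple G hs = (if \<one>\<^bsub>G\<^esub> \<in> set hs then 0 else Poly_Mapping.single hs 1)"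

definition grp_chains :: "('a, 'm) monoid_scheme \<Rightarrow> nat \<Rightarrow> ('a list \<Rightarrow>\<^sub>0 'k::field) set" where
  "grp_chains G n = free_on (nontriv_tuples G n)"

definition grp_boundary :: "('a, 'm) monoid_scheme \<Rightarrow> ('a list \<Rightarrow>\<^sub>0 'k::field) \<Rightarrow> ('a list \<Rightarrow>\<^sub>0 'k)" where
  "grp_boundary G = lin_ext (\<lambda>hs. let n = length hs in
     if n = 0 then 0
     else grp_tuple G (tl hs)
          + (\<Sum>i=1..n-1. scale ((-1)^i) (grp_tuple G (merge G i hs)))
          + scale ((-1)^n) (grp_tuple G (butlast hs)))"

subsection \<open>Hochschild chains of the group algebra\<close>

definition hoch_tuple :: "('a, 'm) monoid_scheme \<Rightarrow> 'a \<times> 'a list \<Rightarrow> ('a \<times> 'a list \<Rightarrow>\<^sub>0 'k::field)" where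
  "hoch_tuple G t = (if \<one>\<^bsub>G\<^esub> \<in> set (snd t) then 0 else Poly_Mapping.single t 1)"

definition hoch_chains :: "('a, 'm) monoid_scheme \<Rightarrow> nat \<Rightarrow> ('a \<times> 'a list \<Rightarrow>\<^sub>0 'k::field) set" where
  "hoch_chains G n = free_on (carrier G \<times> nontriv_tuples G n)"

definition hoch_boundary ::
  "('a, 'm) monoid_scheme \<Rightarrow> ('a \<times> 'a list \<Rightarrow>\<^sub>0 'k::field) \<Rightarrow> ('a \<times> 'a list \<Rightarrow>\<^sub>0 'k)" where
  "hoch_boundary G = lin_ext (\<lambda>(g0, gs). let n = length gs in
     if n = 0 then 0
     else hoch_tuple G (g0 \<otimes>\<^bsub>G\<^esub> hd gs, tl gs)
          + (\<Sum>i=1..n-1. scale ((-1)^i) (hoch_tuple G (g0, merge G i gs)))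
          + scale ((-1)^n) (hoch_tuple G (last gs \<otimes>\<^bsub>G\<^esub> g0, butlast gs)))"

definition connes ::
  "('a, 'm) monoid_scheme \<Rightarrow> ('a \<times> 'a list \<Rightarrow>\<^sub>0 'k::field) \<Rightarrow> ('a \<times> 'a list \<Rightarrow>\<^sub>0 'k)" where
  "connes G = lin_ext (\<lambda>(g0, gs). let s = length gs in
     \<Sum>i=0..s. scale ((-1)^(i * s))
       (hoch_tuple G (\<one>\<^bsub>G\<^esub>, drop i (g0 # gs) @ take i (g0 # gs))))"

section \<open>The summand of a conjugacy class\<close>

text \<open>\<open>inv_twist G [g\<^sub>1, \<dots>, g\<^sub>s] u\<close> is \<open>g\<^sub>s\<inverse> \<cdots> g\<^sub>1\<inverse> u\<close>.\<close>

definition inv_twist :: "('a, 'm) monoid_scheme \<Rightarrow> 'a list \<Rightarrow> 'a \<Rightarrow> 'a" where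
  "inv_twist G gs u = foldl (\<lambda>a g. inv\<^bsub>G\<^esub> g \<otimes>\<^bsub>G\<^esub> a) u gs"

definition class_chains ::
  "('a, 'm) monoid_scheme \<Rightarrow> 'a \<Rightarrow> nat \<Rightarrow> ('a \<times> 'a list \<Rightarrow>\<^sub>0 'k::field) set" where
  "class_chains G x s =
     free_on {(inv_twist G gs u, gs) | u gs. u \<in> conj_class G x \<and> gs \<in> nontriv_tuples G s}"

definition iota ::
  "('a, 'm) monoid_scheme \<Rightarrow> 'a \<Rightarrow> ('a list \<Rightarrow>\<^sub>0 'k::field) \<Rightarrow> ('a \<times> 'a list \<Rightarrow>\<^sub>0 'k)" where
  "iota G x = lin_ext (\<lambda>hs. hoch_tuple G (inv_twist G hs x, hs))"

definition coset_rep :: "('a, 'm) monoid_scheme \<Rightarrow> 'a set \<Rightarrow> 'a set \<Rightarrow> 'a \<Rightarrow> 'a" where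
  "coset_rep G H T g = (THE t. t \<in> T \<and> g \<in> H #>\<^bsub>G\<^esub> t)"

text \<open>
  For a representative \<open>t\<close>, the tuple \<open>(h\<^sub>1, \<dots>, h\<^sub>n)\<close> determined by \<open>t g\<^sub>1 = h\<^sub>1 t\<^sub>1\<close>,
  \<open>t\<^sub>1 g\<^sub>2 = h\<^sub>2 t\<^sub>2\<close>, \dots, where each \<open>t\<^sub>j\<close> is a representative and each \<open>h\<^sub>j\<close> lies in \<open>H\<close>.
\<close>

primrec coset_walk :: "('a, 'm) monoid_scheme \<Rightarrow> 'a set \<Rightarrow> 'a set \<Rightarrow> 'a \<Rightarrow> 'a list \<Rightarrow> 'a list" where
  "coset_walk G H T t [] = []"
| "coset_walk G H T t (g # gs) =
     (let t' = coset_rep G H T (t \<otimes>\<^bsub>G\<^esub> g)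
      in (t \<otimes>\<^bsub>G\<^esub> g \<otimes>\<^bsub>G\<^esub> inv\<^bsub>G\<^esub> t') # coset_walk G H T t' gs)"

text \<open>
  A basis tuple of the summand of \<open>x\<close> determines \<open>g\<^sub>0\<close> only up to left multiplication by the
  centralizer, hence determines its right coset; the choice of \<open>g\<^sub>0\<close> below is therefore immaterial.
\<close>

definition rho ::
  "('a, 'm) monoid_scheme \<Rightarrow> 'a set \<Rightarrow> 'a \<Rightarrow> ('a \<times> 'a list \<Rightarrow>\<^sub>0 'k::field) \<Rightarrow> ('a list \<Rightarrow>\<^sub>0 'k)" where
  "rho G T x = lin_ext (\<lambda>(a, gs).
     let g0 = (SOME g. g \<in> carrier G \<and> a = inv_twist G gs (inv\<^bsub>G\<^esub> g \<otimes>\<^bsub>G\<^esub> x \<otimes>\<^bsub>G\<^esub> g))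
     in grp_tuple G (coset_walk G (centralizer G x) T (coset_rep G (centralizer G x) T g0) gs))"

section \<open>The homology groups and the induced maps\<close>

abbreviation H_class :: "('a, 'm) monoid_scheme \<Rightarrow> 'a \<Rightarrow> nat \<Rightarrow> ('a \<times> 'a list \<Rightarrow>\<^sub>0 'k::field) set set" where
  "H_class G x n \<equiv> homology (class_chains G x) (hoch_boundary G) n"

abbreviation H_cent :: "('a, 'm) monoid_scheme \<Rightarrow> 'a \<Rightarrow> nat \<Rightarrow> ('a list \<Rightarrow>\<^sub>0 'k::field) set set" where
  "H_cent G x n \<equiv>
     homology (grp_chains (centralizer_group G x)) (grp_boundary (centralizer_group G x)) n"

definition connes_HH ::
  "('a, 'm) monoid_scheme \<Rightarrow> nat \<Rightarrow> ('a \<times> 'a list \<Rightarrow>\<^sub>0 'k::field) set \<Rightarrow> ('a \<times> 'a list \<Rightarrow>\<^sub>0 'k) set" where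
  "connes_HH G s = hmap (hoch_chains G) (hoch_boundary G) (Suc s) (connes G)"

definition connes_class ::
  "('a, 'm) monoid_scheme \<Rightarrow> 'a \<Rightarrow> nat \<Rightarrow> ('a \<times> 'a list \<Rightarrow>\<^sub>0 'k::field) set \<Rightarrow> ('a \<times> 'a list \<Rightarrow>\<^sub>0 'k) set"
  where
  "connes_class G x s = hmap (class_chains G x) (hoch_boundary G) (Suc s) (connes G)"

definition rho_homology ::
  "('a, 'm) monoid_scheme \<Rightarrow> 'a set \<Rightarrow> 'a \<Rightarrow> nat \<Rightarrow> ('a \<times> 'a list \<Rightarrow>\<^sub>0 'k::field) set \<Rightarrow> ('a list \<Rightarrow>\<^sub>0 'k) set"
  where
  "rho_homology G T x n =
     hmap (grp_chains (centralizer_group G x)) (grp_boundary (centralizer_group G x)) n (rho G T x)"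

text \<open>
  The map corresponding to \<open>B\<^sub>x\<close> under the isomorphisms induced by \<open>\<rho>\<^sub>x\<close>, that is
  \<open>(\<rho>\<^sub>x)\<^sub>* \<circ> (B\<^sub>x)\<^sub>* \<circ> ((\<rho>\<^sub>x)\<^sub>*)\<inverse>\<close>.
\<close>

definition Btilde ::
  "('a, 'm) monoid_scheme \<Rightarrow> 'a set \<Rightarrow> 'a \<Rightarrow> nat \<Rightarrow> ('a list \<Rightarrow>\<^sub>0 'k::field) set \<Rightarrow> ('a list \<Rightarrow>\<^sub>0 'k) set" where
  "Btilde G T x s c =
     rho_homology G T x (Suc s)
       (connes_class G x s (inv_into (H_class G x s) (rho_homology G T x s) c))"

text \<open>
  The embedding of \<open>H\<^sub>n(C\<^sub>G(x), k)\<close> as the summand of \<open>x\<close> in the additive decomposition of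
  \<open>HH\<^sub>n(kG, kG)\<close>: the map induced by \<open>iota\<close> followed by the inclusion of the subcomplex.
\<close>

definition summand_embedding ::
  "('a, 'm) monoid_scheme \<Rightarrow> 'a \<Rightarrow> nat \<Rightarrow> ('a list \<Rightarrow>\<^sub>0 'k::field) set \<Rightarrow> ('a \<times> 'a list \<Rightarrow>\<^sub>0 'k) set" where
  "summand_embedding G x n = hmap (hoch_chains G) (hoch_boundary G) n (iota G x)"

definition Btilde_chain ::
  "('a, 'm) monoid_scheme \<Rightarrow> 'a set \<Rightarrow> 'a \<Rightarrow> ('a list \<Rightarrow>\<^sub>0 'k::field) \<Rightarrow> ('a list \<Rightarrow>\<^sub>0 'k)" where
  "Btilde_chain G T x = rho G T x \<circ> connes G \<circ> iota G x"

end

theory Submission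
  imports Defs "HOL.Modules"
begin

text \<open>
  The Hochschild tuple \<open>(g\<^sub>s\<inverse> \<cdots> g\<^sub>1\<inverse> u, g\<^sub>1, \<dots>, g\<^sub>s)\<close> is best read as a path of length \<open>s\<close> that
  starts at \<open>u\<close> in the action groupoid of \<open>G\<close> on itself by conjugation: the vertices are the elements
  of \<open>G\<close>, and \<open>g\<close> is an arrow from \<open>u\<close> to \<open>g\<inverse> u g\<close>. In these coordinates the Hochschild differential is
  the bar differential, whose zeroth face drops the first arrow and moves the starting vertex, and
  whose other faces leave the starting vertex alone. The summand of \<open>x\<close> is the connected component
  of \<open>x\<close>, and the centralizer is the group of loops at \<open>x\<close>; \<open>\<iota>\<close> is the inclusion of these loops, and
  the transversal \<open>T\<close>, which picks an arrow \<open>t : x \<rightarrow> t\<inverse> x t\<close> to each vertex, defines the retraction \<open>\<rho>\<close>.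

  Four facts give the theorem.

  \<^item> \<open>\<iota>\<close> and \<open>\<rho>\<close> are chain maps and \<open>\<rho> \<circ> \<iota>\<close> is the identity (\<open>iota_boundary\<close>, \<open>rho_boundary\<close>,
    \<open>rho_iota\<close>).
  \<^item> The arrows \<open>t\<close> form a natural isomorphism from \<open>\<iota> \<circ> \<rho>\<close> to the identity. The associated prism
    operator is a chain homotopy (\<open>prism_homotopy\<close>, \<open>deform_homotopy\<close>), so \<open>\<iota>\<close> and \<open>\<rho>\<close> induce mutually
    inverse maps on homology.
  \<^item> The Connes operator anticommutes with the Hochschild differential (\<open>hoch_boundary_connes\<close>) and
    preserves the summand (\<open>connes_closed\<close>), hence it acts on homology, and the transported map
    is induced by \<open>\<rho> \<circ> B \<circ> \<iota>\<close> (\<open>Btilde_hclass\<close>). Its compatibility with \<open>B\<close> on the whole Hochschild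
    homology is again the homotopy between \<open>\<iota> \<circ> \<rho>\<close> and the identity (\<open>Btilde_compatible\<close>).
  \<^item> For a tuple \<open>(h\<^sub>1, \<dots>, h\<^sub>s)\<close> in the centralizer, each term of \<open>B (\<iota> (h\<^sub>1, \<dots>, h\<^sub>s))\<close> is \<open>(1, w)\<close>, with \<open>w\<close> a
    rotation of \<open>(h\<^sub>s\<inverse> \<cdots> h\<^sub>1\<inverse> x, h\<^sub>1, \<dots>, h\<^sub>s)\<close>. The entries of \<open>w\<close> commute with \<open>x\<close> and have product \<open>x\<close>, so this
    term is a loop at \<open>x\<close>, and \<open>\<rho>\<close> sends it to \<open>w\<close>. This is the formula (\<open>Btilde_chain_bas\<close>).
\<close>

section \<open>Linear extension\<close>

abbreviation bas :: "'b \<Rightarrow> ('b \<Rightarrow>\<^sub>0 'k::field)" where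
  "bas t \<equiv> Poly_Mapping.single t 1"

lemma lookup_scale [simp]: "Poly_Mapping.lookup (scale a p) t = a * Poly_Mapping.lookup p t"
  by (cases "Poly_Mapping.lookup p t = 0") (simp_all add: scale_def Poly_Mapping.map.rep_eq)

interpretation chain: module "scale :: 'k::field \<Rightarrow> ('b \<Rightarrow>\<^sub>0 'k) \<Rightarrow> ('b \<Rightarrow>\<^sub>0 'k)"
  by standard (auto intro!: poly_mapping_eqI simp: lookup_add algebra_simps)

lemma lin_ext_superset:
  assumes "finite S" "Poly_Mapping.keys p \<subseteq> S"
  shows "lin_ext f p = (\<Sum>t\<in>S. scale (Poly_Mapping.lookup p t) (f t))"
  unfolding lin_ext_def
  by (rule sum.mono_neutral_left) (use assms in \<open>auto simp: in_keys_iff\<close>)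

lemma lin_ext_zero [simp]: "lin_ext f 0 = 0"
  by (simp add: lin_ext_def)

lemma lin_ext_add: "lin_ext f (p + q) = lin_ext f p + lin_ext f q"
proof -
  have "finite (Poly_Mapping.keys p \<union> Poly_Mapping.keys q)"
    "Poly_Mapping.keys (p + q) \<subseteq> Poly_Mapping.keys p \<union> Poly_Mapping.keys q"
    using keys_add[of p q] by auto
  then show ?thesis
    by (simp add: lin_ext_superset[of "Poly_Mapping.keys p \<union> Poly_Mapping.keys q"] lookup_add
        chain.scale_left_distrib sum.distrib)
qed

lemma lin_ext_scale: "lin_ext f (scale a p) = scale a (lin_ext f p)"
proof -
  have "Poly_Mapping.keys (scale a p) \<subseteq> Poly_Mapping.keys p"
    by (auto simp: in_keys_iff)
  then show ?thesis
    by (simp add: lin_ext_superset[of "Poly_Mapping.keys p"] chain.scale_sum_right)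
qed

interpretation lin_ext: additive "lin_ext f"
  by standard (rule lin_ext_add)

lemmas lin_ext_minus = lin_ext.minus
lemmas lin_ext_diff = lin_ext.diff
lemmas lin_ext_sum = lin_ext.sum
lemmas lin_ext_linear = lin_ext_add lin_ext_minus lin_ext_diff lin_ext_scale lin_ext_sum

lemma lin_ext_bas [simp]: "lin_ext f (bas t) = f t"
  by (simp add: lin_ext_def)

lemma lin_ext_cong: "(\<And>t. t \<in> Poly_Mapping.keys p \<Longrightarrow> f t = g t) \<Longrightarrow> lin_ext f p = lin_ext g p"
  by (simp add: lin_ext_def)

lemma lin_ext_comp: "lin_ext f (lin_ext g p) = lin_ext (\<lambda>t. lin_ext f (g t)) p"
  unfolding lin_ext_def[of g p] lin_ext_def[of "\<lambda>t. lin_ext f (g t)" p]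
  by (simp add: lin_ext_sum lin_ext_scale)

lemma lin_ext_zero_fun [simp]: "lin_ext (\<lambda>t. 0) p = 0"
  by (simp add: lin_ext_def)

lemma lin_ext_plus_fun: "lin_ext (\<lambda>t. f t + g t) p = lin_ext f p + lin_ext g p"
  by (simp add: lin_ext_def sum.distrib chain.scale_right_distrib)

lemma lin_ext_minus_fun: "lin_ext (\<lambda>t. - f t) p = - lin_ext f p"
  by (simp add: lin_ext_def sum_negf)

lemma lin_ext_diff_fun: "lin_ext (\<lambda>t. f t - g t) p = lin_ext f p - lin_ext g p"
  by (simp add: lin_ext_def sum_subtractf chain.scale_right_diff_distrib)

lemma lin_ext_sum_fun: "lin_ext (\<lambda>t. \<Sum>i\<in>I. f i t) p = (\<Sum>i\<in>I. lin_ext (f i) p)"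
  by (simp add: lin_ext_def chain.scale_sum_right sum.swap[of _ _ I])

lemma lin_ext_bas_id: "lin_ext bas p = p"
  by (rule poly_mapping_eqI)
     (simp add: lin_ext_def lookup_sum lookup_single when_def in_keys_iff if_distrib[of "(*) _"] cong: if_cong)

lemma free_on_bas: "t \<in> S \<Longrightarrow> bas t \<in> free_on S"
  by (simp add: free_on_def)

lemma subspace_free_on: "chain.subspace (free_on S)"
  unfolding chain.subspace_def free_on_def
  by (auto simp: in_keys_iff subset_iff lookup_add) (metis add.right_neutral)

lemmas free_on_zero = chain.subspace_0[OF subspace_free_on]
lemmas free_on_add = chain.subspace_add[OF subspace_free_on]
lemmas free_on_scale = chain.subspace_scale[OF subspace_free_on]
lemmas free_on_minus = chain.subspace_neg[OF subspace_free_on]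
lemmas free_on_diff = chain.subspace_diff[OF subspace_free_on]
lemmas free_on_sum = chain.subspace_sum[OF subspace_free_on]

lemma lin_ext_in_free_on:
  assumes "p \<in> free_on S" "\<And>t. t \<in> S \<Longrightarrow> f t \<in> free_on S'"
  shows "lin_ext f p \<in> free_on S'"
  using assms unfolding lin_ext_def
  by (intro free_on_sum free_on_scale) (auto simp: free_on_def)

lemma free_on_mono: "S \<subseteq> S' \<Longrightarrow> p \<in> free_on S \<Longrightarrow> p \<in> free_on S'"
  by (auto simp: free_on_def)

lemma lin_ext_cong_on:
  "p \<in> free_on S \<Longrightarrow> (\<And>t. t \<in> S \<Longrightarrow> f t = g t) \<Longrightarrow> lin_ext f p = lin_ext g p"
  by (rule lin_ext_cong) (auto simp: free_on_def)

section \<open>The bar differential on words\<close>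

definition push :: "'b \<Rightarrow> ('b list \<Rightarrow>\<^sub>0 'k::field) \<Rightarrow> ('b list \<Rightarrow>\<^sub>0 'k)" where
  "push g = lin_ext (\<lambda>w. bas (g # w))"

lemma push_bas [simp]: "push g (bas w) = bas (g # w)"
  by (simp add: push_def)

lemma push_zero [simp]: "push g 0 = 0"
  by (simp add: push_def)

lemma push_linear:
  "push g (p + q) = push g p + push g q" "push g (- p) = - push g p"
  "push g (p - q) = push g p - push g q" "push g (scale a p) = scale a (push g p)"
  "push g (sum h I) = (\<Sum>i\<in>I. push g (h i))"
  by (simp_all add: push_def lin_ext_linear)

lemma lin_ext_push: "lin_ext f (push g p) = lin_ext (\<lambda>w. f (g # w)) p"
  by (simp add: push_def lin_ext_comp)

lemma push_lin_ext: "push g (lin_ext f p) = lin_ext (\<lambda>w. push g (f w)) p"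
  by (simp add: push_def lin_ext_comp)

text \<open>
  The value on the empty word is chosen so that the recursion for \<open>bar_tail\<close> below is uniform: the
  last face of a one-letter word is the empty word.
\<close>

primrec head_mult :: "('a, 'm) monoid_scheme \<Rightarrow> 'a \<Rightarrow> 'a list \<Rightarrow> 'a list" where
  "head_mult G g [] = []"
| "head_mult G g (h # w) = (g \<otimes>\<^bsub>G\<^esub> h) # w"

text \<open>
  All faces of the bar differential except the zeroth one, with their signs. The faces of \<open>g # w\<close> of
  index at least two are the faces of \<open>w\<close> of index at least one with \<open>g\<close> in front, which
  gives a recursion along the word. The inductions on the length of a path rest on this recursion.
\<close>

primrec bar_tail :: "('a, 'm) monoid_scheme \<Rightarrow> 'a list \<Rightarrow> ('a list \<Rightarrow>\<^sub>0 'k::field)" where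
  "bar_tail G [] = 0"
| "bar_tail G (g # w) = - bas (head_mult G g w) - push g (bar_tail G w)"

lemma merge_Cons_Suc: "i \<ge> 1 \<Longrightarrow> merge G (Suc i) (g # w) = g # merge G i w"
  by (cases i) (simp_all add: merge_def)

lemma merge_Cons_1: "merge G (Suc 0) (g # h # w) = (g \<otimes>\<^bsub>G\<^esub> h) # w"
  by (simp add: merge_def)

lemma bar_tail_eq:
  assumes "gs \<noteq> []"
  shows "(bar_tail G gs :: 'a list \<Rightarrow>\<^sub>0 'k::field) = (\<Sum>i=1..length gs - 1. scale ((-1)^i) (bas (merge G i gs)))
            + scale ((-1)^length gs) (bas (butlast gs))"
  using assms
proof (induction gs)
  case (Cons g gs)
  show ?case
  proof (cases gs)
    case (Cons h w)
    have "(\<Sum>i=1..length gs. scale ((-1)^i) (bas (merge G i (g # gs)) :: 'a list \<Rightarrow>\<^sub>0 'k))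
       = scale ((-1)^1) (bas (merge G 1 (g # gs)))
         + (\<Sum>i=1..length gs - 1. scale ((-1)^Suc i) (bas (merge G (Suc i) (g # gs))))"
      by (subst sum.atLeast_Suc_atMost, use Cons in simp,
          subst sum.shift_bounds_cl_Suc_ivl[symmetric]) (simp add: Cons)
    also have "(\<Sum>i=1..length gs - 1. scale ((-1)^Suc i) (bas (merge G (Suc i) (g # gs)) :: 'a list \<Rightarrow>\<^sub>0 'k))
       = (\<Sum>i=1..length gs - 1. - push g (scale ((-1)^i) (bas (merge G i gs))))"
      by (rule sum.cong) (auto simp: merge_Cons_Suc push_linear)
    finally have *: "(\<Sum>i=1..length gs. scale ((-1)^i) (bas (merge G i (g # gs)) :: 'a list \<Rightarrow>\<^sub>0 'k))
       = - bas (head_mult G g gs)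
         - push g (\<Sum>i=1..length gs - 1. scale ((-1)^i) (bas (merge G i gs)))"
      by (simp add: Cons merge_Cons_1 push_linear sum_negf)
    have "(bar_tail G (g # gs) :: 'a list \<Rightarrow>\<^sub>0 'k) = - bas (head_mult G g gs) - push g (bar_tail G gs)"
      by simp
    also have "\<dots> = (\<Sum>i=1..length gs. scale ((-1)^i) (bas (merge G i (g # gs))))
         - scale ((-1)^length gs) (bas (butlast (g # gs)))"
    proof -
      have "gs \<noteq> []" by (simp add: Cons)
      then show ?thesis
        unfolding * by (simp add: Cons.IH push_linear algebra_simps)
    qed
    finally show ?thesis
      by simp
  qed simp
qed simp

lemma lin_ext_bar_tail:
  "gs \<noteq> [] \<Longrightarrow> lin_ext f (bar_tail G gs) =
     (\<Sum>i=1..length gs - 1. scale ((-1)^i) (f (merge G i gs))) + scale ((-1)^length gs) (f (butlast gs))"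
  by (simp add: bar_tail_eq lin_ext_linear)

context group begin

lemma head_mult_one: "set w \<subseteq> carrier G \<Longrightarrow> head_mult G \<one> w = w"
  by (cases w) auto

text \<open>
  In the normalized complex a word with an entry \<open>1\<close> in position \<open>j\<close> has at most the faces \<open>j - 1\<close> and \<open>j\<close>
  left; they agree and have opposite signs. For \<open>j = 1\<close> the partner is the zeroth face, which is not part of
  \<open>bar_tail\<close>, so one term remains. The function \<open>f\<close> stands for any passage to a normalized complex, and its
  generality is what lets the induction absorb the letters in front.
\<close>

lemma bar_tail_degenerate:
  assumes "set gs \<subseteq> carrier G" "\<one> \<in> set gs" "\<And>w. \<one> \<in> set w \<Longrightarrow> f w = 0"
  shows "lin_ext f (bar_tail G gs) = (if hd gs = \<one> then - f (tl gs) else 0)"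
  using assms
proof (induction gs arbitrary: f)
  case (Cons g w)
  show ?case
  proof (cases "g = \<one>")
    case True
    then show ?thesis
      using Cons.prems by (simp add: lin_ext_linear lin_ext_push head_mult_one)
  next
    case False
    then have "\<one> \<in> set w"
      using Cons.prems by auto
    then have "lin_ext (\<lambda>v. f (g # v)) (bar_tail G w) = (if hd w = \<one> then - f (g # tl w) else 0)"
      using Cons.prems by (intro Cons.IH) auto
    then show ?thesis
      using Cons.prems False \<open>\<one> \<in> set w\<close>
      by (cases w) (auto simp: lin_ext_linear lin_ext_push)
  qed
qed simp

lemma head_mult_closed:
  "g \<in> carrier G \<Longrightarrow> set w \<subseteq> carrier G \<Longrightarrow> set (head_mult G g w) \<subseteq> carrier G"
  by (cases w) auto

lemma bar_tail_closed:
  "set gs \<subseteq> carrier G \<Longrightarrow>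
     (bar_tail G gs :: 'a list \<Rightarrow>\<^sub>0 'k::field) \<in> free_on {w. set w \<subseteq> carrier G \<and> Suc (length w) = length gs}"
proof (induction gs)
  case (Cons g w)
  have "(push g (bar_tail G w) :: 'a list \<Rightarrow>\<^sub>0 'k)
      \<in> free_on {v. set v \<subseteq> carrier G \<and> Suc (length v) = length (g # w)}"
    unfolding push_def
  proof (rule lin_ext_in_free_on[OF Cons.IH])
    show "set w \<subseteq> carrier G"
      using Cons.prems by simp
  qed (rule free_on_bas, use Cons.prems in auto)
  moreover have "(bas (head_mult G g w) :: 'a list \<Rightarrow>\<^sub>0 'k)
      \<in> free_on {v. set v \<subseteq> carrier G \<and> Suc (length v) = length (g # w)}"
    using Cons.prems head_mult_closed[of g w] by (intro free_on_bas) (cases w; auto)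
  ultimately show ?case
    by (simp add: free_on_diff free_on_minus)
qed (simp add: free_on_zero)

end

section \<open>Hochschild chains as chains of the action groupoid\<close>

context group begin

definition word_prod :: "'a list \<Rightarrow> 'a" where
  "word_prod gs = foldr (\<otimes>) gs \<one>"

lemma word_prod_simps [simp]: "word_prod [] = \<one>" "word_prod (g # gs) = g \<otimes> word_prod gs"
  by (simp_all add: word_prod_def)

lemma word_prod_closed [simp, intro]: "set gs \<subseteq> carrier G \<Longrightarrow> word_prod gs \<in> carrier G"
  by (induction gs) auto

lemma word_prod_append:
  "set vs \<subseteq> carrier G \<Longrightarrow> set ws \<subseteq> carrier G \<Longrightarrow>
     word_prod (vs @ ws) = word_prod vs \<otimes> word_prod ws"
  by (induction vs) (auto simp: m_assoc)

lemma word_prod_merge: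
  assumes "set gs \<subseteq> carrier G" "i \<ge> 1" "i < length gs"
  shows "word_prod (merge G i gs) = word_prod gs"
proof -
  have split: "gs = take (i - 1) gs @ [gs ! (i - 1), gs ! i] @ drop (i + 1) gs"
    using assms id_take_nth_drop[of "i - 1" gs] Cons_nth_drop_Suc[of i gs] by simp
  obtain vs g h ws where gs: "gs = vs @ [g, h] @ ws" and m: "merge G i gs = vs @ [g \<otimes> h] @ ws"
    using split unfolding merge_def by metis
  show ?thesis
    using assms(1) unfolding m by (simp add: gs word_prod_append m_assoc)
qed

lemma merge_closed:
  assumes "set gs \<subseteq> carrier G" "i \<ge> 1" "i < length gs"
  shows "set (merge G i gs) \<subseteq> carrier G"
proof -
  have "gs ! (i - 1) \<in> carrier G" "gs ! i \<in> carrier G"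
    using assms by (auto intro!: subsetD[OF assms(1)] nth_mem)
  then show ?thesis
    using assms(1) by (auto simp: merge_def dest: in_set_takeD in_set_dropD)
qed

lemma inv_twist_Nil [simp]: "inv_twist G [] u = u"
  by (simp add: inv_twist_def)

lemma inv_twist_Cons [simp]: "inv_twist G (g # gs) u = inv_twist G gs (inv g \<otimes> u)"
  by (simp add: inv_twist_def)

lemma inv_twist_snoc: "inv_twist G (gs @ [g]) u = inv g \<otimes> inv_twist G gs u"
  by (simp add: inv_twist_def)

lemma inv_twist_eq:
  "set gs \<subseteq> carrier G \<Longrightarrow> u \<in> carrier G \<Longrightarrow> inv_twist G gs u = inv (word_prod gs) \<otimes> u"
  by (induction gs arbitrary: u) (auto simp: inv_mult_group m_assoc)

lemma inv_twist_closed: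
  "set gs \<subseteq> carrier G \<Longrightarrow> u \<in> carrier G \<Longrightarrow> inv_twist G gs u \<in> carrier G"
  by (simp add: inv_twist_eq)

lemma word_prod_inv_twist:
  "set gs \<subseteq> carrier G \<Longrightarrow> u \<in> carrier G \<Longrightarrow> word_prod gs \<otimes> inv_twist G gs u = u"
  by (simp add: inv_twist_eq m_assoc[symmetric])

lemma inv_twist_word_prod:
  "set gs \<subseteq> carrier G \<Longrightarrow> a \<in> carrier G \<Longrightarrow> inv_twist G gs (word_prod gs \<otimes> a) = a"
  by (simp add: inv_twist_eq m_assoc[symmetric])

text \<open>
  The path \<open>gs\<close> with starting vertex \<open>u\<close>, as a normalized Hochschild chain.
\<close>

definition arrow :: "'a \<Rightarrow> 'a list \<Rightarrow> ('a \<times> 'a list \<Rightarrow>\<^sub>0 'k::field)" where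
  "arrow u gs = hoch_tuple G (inv_twist G gs u, gs)"

lemma arrow_degenerate: "\<one> \<in> set gs \<Longrightarrow> arrow u gs = 0"
  by (simp add: arrow_def hoch_tuple_def)

text \<open>
  The Hochschild boundary of a single tuple. By \<open>hoch_boundary_hoch_tuple\<close> this is the boundary of the
  normalized chain of the tuple also when the tuple is degenerate.
\<close>

definition hoch_faces :: "'a \<times> 'a list \<Rightarrow> ('a \<times> 'a list \<Rightarrow>\<^sub>0 'k::field)" where
  "hoch_faces = (\<lambda>(g0, gs). let n = length gs in
     if n = 0 then 0
     else hoch_tuple G (g0 \<otimes> hd gs, tl gs)
          + (\<Sum>i=1..n-1. scale ((-1)^i) (hoch_tuple G (g0, merge G i gs)))
          + scale ((-1)^n) (hoch_tuple G (last gs \<otimes> g0, butlast gs)))"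

lemma hoch_boundary_eq: "hoch_boundary G = lin_ext hoch_faces"
  by (simp add: hoch_boundary_def hoch_faces_def)

text \<open>
  Multiplying the coefficient \<open>g\<^sub>s\<inverse> \<cdots> g\<^sub>1\<inverse> u\<close> by \<open>g\<^sub>1\<close> on the right conjugates \<open>u\<close> by \<open>g\<^sub>1\<close>, whereas the inner faces and
  the last face keep \<open>u\<close>, because \<open>g\<^sub>1 \<cdots> g\<^sub>s\<close> and the coefficient change together.
\<close>

lemma hoch_faces_arrow:
  assumes u: "u \<in> carrier G" and gs: "set (g # gs) \<subseteq> carrier G"
  shows "hoch_faces (inv_twist G (g # gs) u, g # gs)
           = arrow (inv g \<otimes> u \<otimes> g) gs + lin_ext (arrow u) (bar_tail G (g # gs))"
proof -
  let ?w = "g # gs" let ?a = "inv_twist G ?w u"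
  have "?a \<otimes> g = inv_twist G gs (inv g \<otimes> u \<otimes> g)"
    using u gs by (simp add: inv_twist_eq m_assoc)
  moreover have "inv_twist G (merge G i ?w) u = ?a" if "i \<in> {1..length ?w - 1}" for i
    using that gs u word_prod_merge[of ?w i] merge_closed[of ?w i]
      inv_twist_eq[of ?w] inv_twist_eq[of "merge G i ?w"] by auto
  moreover have "inv_twist G (butlast ?w) u = last ?w \<otimes> ?a"
  proof -
    obtain vs l where w: "?w = vs @ [l]"
      by (cases ?w rule: rev_cases) auto
    then have "set (vs @ [l]) \<subseteq> carrier G"
      using gs by simp
    then have "l \<in> carrier G" "inv_twist G vs u \<in> carrier G"
      using u inv_twist_closed by auto
    then show ?thesis
      unfolding w by (simp add: inv_twist_snoc m_assoc[symmetric])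
  qed
  ultimately show ?thesis
    by (simp add: hoch_faces_def Let_def lin_ext_bar_tail arrow_def add.assoc
        del: bar_tail.simps inv_twist_Cons)
qed

text \<open>
  The two faces of a degenerate tuple that survive normalization cancel.
\<close>

lemma hoch_boundary_hoch_tuple:
  assumes "a \<in> carrier G" "set gs \<subseteq> carrier G"
  shows "hoch_boundary G (hoch_tuple G (a, gs)) = (hoch_faces (a, gs) :: _ \<Rightarrow>\<^sub>0 'k::field)"
proof (cases "\<one> \<in> set gs")
  case True
  then obtain g w where w: "gs = g # w" by (cases gs) auto
  define u where "u = word_prod gs \<otimes> a"
  have u: "u \<in> carrier G" "inv_twist G gs u = a"
    using assms inv_twist_word_prod by (auto simp: u_def)
  have "(hoch_faces (a, gs) :: _ \<Rightarrow>\<^sub>0 'k) = arrow (inv g \<otimes> u \<otimes> g) w + lin_ext (arrow u) (bar_tail G gs)"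
    using hoch_faces_arrow[of u g w] u assms w by auto
  also have "(lin_ext (arrow u) (bar_tail G gs) :: _ \<Rightarrow>\<^sub>0 'k) = (if hd gs = \<one> then - arrow u (tl gs) else 0)"
    using assms True by (intro bar_tail_degenerate) (auto intro: arrow_degenerate)
  also have "arrow (inv g \<otimes> u \<otimes> g) w + \<dots> = 0"
    using u True by (auto simp: w arrow_degenerate)
  finally show ?thesis
    using True by (simp add: hoch_tuple_def hoch_boundary_eq)
qed (simp add: hoch_tuple_def hoch_boundary_eq)

lemma hoch_boundary_arrow_Nil: "hoch_boundary G (arrow u []) = 0"
  by (simp add: arrow_def hoch_tuple_def hoch_boundary_eq hoch_faces_def)

lemma hoch_boundary_arrow_Cons:
  assumes "u \<in> carrier G" "set (g # gs) \<subseteq> carrier G"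
  shows "hoch_boundary G (arrow u (g # gs))
           = arrow (inv g \<otimes> u \<otimes> g) gs + lin_ext (arrow u) (bar_tail G (g # gs))"
  using assms hoch_faces_arrow[OF assms] inv_twist_closed[of "g # gs" u]
  by (simp add: arrow_def[of u "g # gs"] hoch_boundary_hoch_tuple del: inv_twist_Cons bar_tail.simps)

end

section \<open>Signed rotations and the Connes operator\<close>

text \<open>
  The powers of the signed cyclic rotation \<open>\<tau>\<close>: on words of length \<open>n\<close>, the rotation by one
  place carries the sign \<open>(-1)\<^bsup>n-1\<^esup>\<close> of the cyclic permutation. The sign makes \<open>\<tau>\<^sup>n\<close> the identity
  (\<open>sgn_rot_length\<close>).
\<close>

definition sgn_rot :: "nat \<Rightarrow> 'b list \<Rightarrow> ('b list \<Rightarrow>\<^sub>0 'k::field)" where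
  "sgn_rot j w = scale ((-1) ^ (j * (length w - 1))) (bas (rotate j w))"

text \<open>
  The norm \<open>N = 1 + \<tau> + \<dots> + \<tau>\<^bsup>n-1\<^esup>\<close>. Since \<open>\<tau>\<^sup>n = 1\<close>, it absorbs rotations from either side.
\<close>

definition cyc_norm :: "'b list \<Rightarrow> ('b list \<Rightarrow>\<^sub>0 'k::field)" where
  "cyc_norm w = (\<Sum>j<length w. sgn_rot j w)"

lemma sgn_rot_0 [simp]: "sgn_rot 0 w = bas w"
  by (simp add: sgn_rot_def)

lemma sgn_rot_sgn_rot: "lin_ext (sgn_rot i) (sgn_rot j w) = sgn_rot (i + j) w"
  by (simp add: sgn_rot_def lin_ext_scale rotate_rotate power_add[symmetric] add_mult_distrib ac_simps)

lemma sgn_rot_length: "sgn_rot (length w) w = bas w"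
proof -
  have "even (length w * (length w - 1))"
    by (cases "length w") auto
  then show ?thesis
    by (simp add: sgn_rot_def)
qed

lemma sgn_rot_cyc_norm: "lin_ext (sgn_rot i) (cyc_norm w) = (cyc_norm w :: _ \<Rightarrow>\<^sub>0 'k::field)"
proof (induction i)
  case 0
  have "lin_ext (sgn_rot 0) p = p" for p :: "'b list \<Rightarrow>\<^sub>0 'k"
    by (rule trans[OF lin_ext_cong lin_ext_bas_id]) simp
  then show ?case .
next
  case (Suc i)
  have "(lin_ext (sgn_rot (Suc i)) (cyc_norm w) :: _ \<Rightarrow>\<^sub>0 'k) = lin_ext (sgn_rot 1) (lin_ext (sgn_rot i) (cyc_norm w))"
    unfolding lin_ext_comp by (simp add: sgn_rot_sgn_rot)
  also have "\<dots> = lin_ext (sgn_rot 1) (cyc_norm w)"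
    by (simp add: Suc.IH)
  also have "\<dots> = (\<Sum>j<length w. sgn_rot (Suc j) w)"
    by (simp add: cyc_norm_def lin_ext_sum sgn_rot_sgn_rot)
  also have "\<dots> = (\<Sum>j<length w. sgn_rot j w)"
  proof (rule sym)
    show "(\<Sum>j<length w. sgn_rot j w :: _ \<Rightarrow>\<^sub>0 'k) = (\<Sum>j<length w. sgn_rot (Suc j) w)"
      using sum.lessThan_Suc_shift[of "\<lambda>j. sgn_rot j w :: _ \<Rightarrow>\<^sub>0 'k" "length w"]
      by (simp add: sgn_rot_length)
  qed
  finally show ?case
    by (simp add: cyc_norm_def)
qed

lemma cyc_norm_sgn_rot: "lin_ext cyc_norm (sgn_rot i w) = (cyc_norm w :: _ \<Rightarrow>\<^sub>0 'k::field)"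
proof -
  have "lin_ext cyc_norm (sgn_rot i w :: _ \<Rightarrow>\<^sub>0 'k) = (\<Sum>j<length w. lin_ext (sgn_rot j) (sgn_rot i w))"
    by (simp add: sgn_rot_def cyc_norm_def lin_ext_scale chain.scale_sum_right)
  also have "\<dots> = lin_ext (sgn_rot i) (cyc_norm w)"
    by (simp add: sgn_rot_sgn_rot cyc_norm_def lin_ext_sum add.commute)
  finally show ?thesis
    by (simp add: sgn_rot_cyc_norm)
qed

lemma cyc_norm_eq_inverse_rotations: "(cyc_norm w :: _ \<Rightarrow>\<^sub>0 'k::field) = (\<Sum>i<length w. sgn_rot (length w - i) w)"
proof -
  have "(\<Sum>i<length w. sgn_rot (length w - i) w :: _ \<Rightarrow>\<^sub>0 'k)
      = (\<Sum>i<length w. sgn_rot (Suc (length w - Suc i)) w)"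
    by (rule sum.cong) (auto simp: Suc_diff_Suc)
  also have "\<dots> = (\<Sum>j<length w. sgn_rot (Suc j) w)"
    by (rule sum.nat_diff_reindex)
  also have "\<dots> = lin_ext (sgn_rot 1) (cyc_norm w)"
    by (simp add: cyc_norm_def lin_ext_sum sgn_rot_sgn_rot)
  finally show ?thesis
    by (simp add: sgn_rot_cyc_norm)
qed

text \<open>
  On the cyclic word \<open>(a\<^sub>0, \<dots>, a\<^sub>n)\<close>, \<open>inner_faces\<close> is the operator \<open>b'\<close> of cyclic homology, which leaves out
  the face that multiplies \<open>a\<^sub>n\<close> into \<open>a\<^sub>0\<close>, and \<open>cyc_faces\<close> is the full Hochschild differential \<open>b\<close>.
  One-letter words have degree zero, so \<open>cyc_faces\<close> has to vanish on them.
\<close>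

definition inner_faces :: "('a, 'm) monoid_scheme \<Rightarrow> 'a list \<Rightarrow> ('a list \<Rightarrow>\<^sub>0 'k::field)" where
  "inner_faces G w = (\<Sum>i<length w - 1. scale ((-1)^i) (bas (merge G (Suc i) w)))"

definition cyc_faces :: "('a, 'm) monoid_scheme \<Rightarrow> 'a list \<Rightarrow> ('a list \<Rightarrow>\<^sub>0 'k::field)" where
  "cyc_faces G w = (if length w \<le> 1 then 0 else inner_faces G w
     + scale ((-1)^(length w - 1)) (bas ((last w \<otimes>\<^bsub>G\<^esub> hd w) # tl (butlast w))))"

abbreviation first_merge :: "('a, 'm) monoid_scheme \<Rightarrow> 'a list \<Rightarrow> ('a list \<Rightarrow>\<^sub>0 'k::field)" where
  "first_merge G w \<equiv> bas (merge G 1 w)"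

text \<open>
  Rotate the two letters to be multiplied to the front, multiply them there, and rotate back: with \<open>m\<close>
  the product of the first two letters, the signed face number \<open>i\<close> is \<open>\<tau>\<^bsup>-i\<^esup> \<circ> m \<circ> \<tau>\<^sup>i\<close>. On words of length
  \<open>n + 1\<close> and \<open>n\<close> the two rotations have signs \<open>(-1)\<^bsup>in\<^esup>\<close> and \<open>(-1)\<^bsup>i(n-1)\<^esup>\<close>, whose product is
  \<open>(-1)\<^sup>i\<close>. The inverse rotation is written \<open>\<tau>\<^bsup>n-i\<^esup>\<close> to keep the exponent a natural number.
\<close>

lemma inner_face_eq_rotated_first_merge:
  assumes "Suc i < length w"
  shows "scale ((-1)^i) (bas (merge G (Suc i) w) :: _ \<Rightarrow>\<^sub>0 'k::field)
     = lin_ext (sgn_rot (length w - 1 - i)) (lin_ext (first_merge G) (sgn_rot i w))"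
proof -
  define p where "p = take i w"
  define q where "q = drop (i + 2) w"
  have w: "w = p @ [w ! i, w ! Suc i] @ q" and p: "length p = i"
    using assms id_take_nth_drop[of i w] Cons_nth_drop_Suc[of "Suc i" w] by (simp_all add: p_def q_def)
  obtain g h where w: "w = p @ [g, h] @ q"
    using w by blast
  let ?n = "length w - 1"
  have n: "?n = Suc (i + length q)"
    by (simp add: w p)
  have rot: "rotate i w = g # h # q @ p"
    using rotate_append[of p "[g, h] @ q"] by (simp add: w p)
  have unrot: "rotate (Suc (length q)) ((g \<otimes>\<^bsub>G\<^esub> h) # q @ p) = p @ (g \<otimes>\<^bsub>G\<^esub> h) # q"
    using rotate_append[of "(g \<otimes>\<^bsub>G\<^esub> h) # q" p] by simp
  have m: "merge G (Suc i) w = p @ (g \<otimes>\<^bsub>G\<^esub> h) # q"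
    by (simp add: merge_def w p nth_append)
  have "even (i * ?n + (?n - i) * (?n - 1) + i)"
    unfolding n by (cases "even i"; cases "even (length q)") auto
  then have "(-1::'k) ^ (i * ?n + (?n - i) * (?n - 1)) = (-1) ^ i"
    by (metis even_add minus_one_power_iff)
  then have "scale ((-1)^i) (bas (merge G (Suc i) w) :: 'a list \<Rightarrow>\<^sub>0 'k)
    = scale ((-1) ^ (i * ?n) * (-1) ^ ((?n - i) * (?n - 1))) (bas (p @ (g \<otimes>\<^bsub>G\<^esub> h) # q))"
    by (simp add: m power_add)
  also have "\<dots> = lin_ext (sgn_rot (?n - i)) (lin_ext (first_merge G) (sgn_rot i w))"
    using n by (simp add: sgn_rot_def[of i w] rot lin_ext_scale merge_def sgn_rot_def unrot p ac_simps
        del: rotate_Suc)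
  finally show ?thesis .
qed

text \<open>
  The case \<open>i = n\<close> of the same identity; here \<open>\<tau>\<^bsup>-n\<^esup>\<close> is the identity on words of length \<open>n\<close>.
\<close>

lemma last_face_eq_rotated_first_merge:
  assumes "length w \<ge> 2"
  shows "scale ((-1)^(length w - 1)) (bas ((last w \<otimes>\<^bsub>G\<^esub> hd w) # tl (butlast w)) :: _ \<Rightarrow>\<^sub>0 'k::field)
     = lin_ext (first_merge G) (sgn_rot (length w - 1) w)"
proof -
  obtain p l where p: "w = p @ [l]"
    using assms by (cases w rule: rev_cases) auto
  have "p \<noteq> []"
    using assms p by auto
  then obtain h q where q: "p = h # q"
    by (cases p) auto
  have "rotate (length p) w = l # p"
    using rotate_append[of p "[l]"] by (simp add: p)
  moreover have "(-1::'k) ^ (length p * length p) = (-1) ^ length p"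
    by (simp add: minus_one_power_iff)
  ultimately show ?thesis
    by (simp add: p sgn_rot_def lin_ext_scale merge_def q del: rotate_Suc power_Suc)
qed

lemma length_first_merge: "length w \<ge> 2 \<Longrightarrow> length (merge G 1 w) = length w - 1"
  by (simp add: merge_def)

text \<open>
  The identity \<open>N \<circ> b = b' \<circ> N\<close>. Because faces are rotated copies of \<open>m\<close> and \<open>N\<close> absorbs
  rotations, both sides equal \<open>N \<circ> m \<circ> N\<close>: on the left, \<open>N\<close> swallows each \<open>\<tau>\<^bsup>-i\<^esup>\<close> and the \<open>n + 1\<close> rotations \<open>\<tau>\<^sup>i\<close>
  sum to \<open>N\<close>; on the right, \<open>N\<close> swallows each \<open>\<tau>\<^sup>i\<close> and the \<open>n\<close> rotations \<open>\<tau>\<^bsup>-i\<^esup>\<close> sum to \<open>N\<close>.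
\<close>

lemma cyc_norm_cyc_faces:
  "lin_ext cyc_norm (cyc_faces G w :: _ \<Rightarrow>\<^sub>0 'k::field) = lin_ext (inner_faces G) (cyc_norm w)"
proof (cases "length w \<ge> 2")
  case False
  then have "inner_faces G (rotate j w) = (0 :: _ \<Rightarrow>\<^sub>0 'k)" for j
    by (simp add: inner_faces_def)
  then show ?thesis
    using False by (simp add: cyc_faces_def cyc_norm_def lin_ext_sum sgn_rot_def lin_ext_scale)
next
  case True
  define n where "n = length w - 1"
  have n: "length w = Suc n" "n \<ge> 1"
    using True by (auto simp: n_def)
  let ?m = "lin_ext (first_merge G) :: _ \<Rightarrow> 'a list \<Rightarrow>\<^sub>0 'k"
  let ?N = "lin_ext cyc_norm :: _ \<Rightarrow> 'a list \<Rightarrow>\<^sub>0 'k"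
  have inner: "inner_faces G v = (\<Sum>i<n. lin_ext (sgn_rot (n - i)) (?m (sgn_rot i v)))"
    if "length v = Suc n" for v
    unfolding inner_faces_def using that
    by (auto intro!: sum.cong simp: inner_face_eq_rotated_first_merge)
  have N: "lin_ext cyc_norm (lin_ext (sgn_rot i) p) = lin_ext cyc_norm p"
    for i and p :: "'a list \<Rightarrow>\<^sub>0 'k"
    by (simp add: lin_ext_comp cyc_norm_sgn_rot)
  have cyc: "cyc_faces G w = (\<Sum>i<n. lin_ext (sgn_rot (n - i)) (?m (sgn_rot i w))) + ?m (sgn_rot n w)"
    using True n last_face_eq_rotated_first_merge[of w G]
    by (simp add: cyc_faces_def inner)
  have "?N (cyc_faces G w) = (\<Sum>i<n. ?N (?m (sgn_rot i w))) + ?N (?m (sgn_rot n w))"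
    unfolding cyc by (simp add: lin_ext_linear N)
  also have "\<dots> = ?N (?m (cyc_norm w))"
    by (simp add: cyc_norm_def n lin_ext_linear)
  finally have left: "?N (cyc_faces G w) = ?N (?m (cyc_norm w))" .
  have len: "(cyc_norm w :: _ \<Rightarrow>\<^sub>0 'k) \<in> free_on {v. length v = Suc n}"
    unfolding cyc_norm_def sgn_rot_def using n
    by (intro free_on_sum free_on_scale free_on_bas) simp
  have "lin_ext (inner_faces G) (cyc_norm w :: _ \<Rightarrow>\<^sub>0 'k)
      = lin_ext (\<lambda>v. \<Sum>i<n. lin_ext (sgn_rot (n - i)) (?m (sgn_rot i v))) (cyc_norm w)"
    using len by (rule lin_ext_cong_on) (simp add: inner)
  also have "\<dots> = (\<Sum>i<n. lin_ext (sgn_rot (n - i)) (?m (lin_ext (sgn_rot i) (cyc_norm w))))"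
    by (simp add: lin_ext_sum_fun lin_ext_comp)
  also have "\<dots> = lin_ext (\<lambda>v. \<Sum>i<n. sgn_rot (n - i) v) (?m (cyc_norm w))"
    by (simp add: sgn_rot_cyc_norm lin_ext_sum_fun)
  also have "\<dots> = ?N (?m (cyc_norm w))"
  proof (rule lin_ext_cong_on)
    show "?m (cyc_norm w) \<in> free_on {v. length v = n}"
      using len by (rule lin_ext_in_free_on) (use n in \<open>auto intro: free_on_bas simp: length_first_merge[simplified]\<close>)
  qed (simp add: cyc_norm_eq_inverse_rotations)
  finally show ?thesis
    using left by simp
qed

context group begin

text \<open>
  Two ways to turn a word into a Hochschild tuple: read its first letter as the coefficient, or insert
  the coefficient \<open>1\<close>. The second is the extra degeneracy of the cyclic bar construction.
\<close>

definition cyc_tuple :: "'a list \<Rightarrow> ('a \<times> 'a list \<Rightarrow>\<^sub>0 'k::field)" where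
  "cyc_tuple w = hoch_tuple G (hd w, tl w)"

definition unit_tuple :: "'a list \<Rightarrow> ('a \<times> 'a list \<Rightarrow>\<^sub>0 'k::field)" where
  "unit_tuple w = hoch_tuple G (\<one>, w)"

lemma hoch_faces_eq_cyc_faces: "(hoch_faces (a, gs) :: _ \<Rightarrow>\<^sub>0 'k::field) = lin_ext cyc_tuple (cyc_faces G (a # gs))"
proof (cases gs)
  case (Cons g w)
  have "(\<Sum>i<length gs. scale ((-1)^i) (cyc_tuple (merge G (Suc i) (a # gs)) :: _ \<Rightarrow>\<^sub>0 'k))
     = cyc_tuple (merge G 1 (a # gs))
       + (\<Sum>i=1..length gs - 1. scale ((-1)^i) (cyc_tuple (merge G (Suc i) (a # gs))))"
  proof -
    have "{..<length gs} = insert 0 {1..length gs - 1}"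
      using Cons by auto
    then show ?thesis by simp
  qed
  also have "\<dots> = hoch_tuple G (a \<otimes> hd gs, tl gs)
       + (\<Sum>i=1..length gs - 1. scale ((-1)^i) (hoch_tuple G (a, merge G i gs)))"
    by (auto intro!: arg_cong2[of _ _ _ _ "(+)"] sum.cong simp: cyc_tuple_def merge_Cons_Suc Cons merge_Cons_1)
  finally show ?thesis
    by (simp add: hoch_faces_def cyc_faces_def inner_faces_def lin_ext_linear Let_def Cons)
       (simp add: cyc_tuple_def)
qed (simp add: hoch_faces_def cyc_faces_def)

definition connes_term :: "'a \<times> 'a list \<Rightarrow> ('a \<times> 'a list \<Rightarrow>\<^sub>0 'k::field)" where
  "connes_term = (\<lambda>(g0, gs). let s = length gs in
     \<Sum>i=0..s. scale ((-1)^(i * s)) (hoch_tuple G (\<one>, drop i (g0 # gs) @ take i (g0 # gs))))"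

lemma connes_eq: "connes G = lin_ext connes_term"
  by (simp add: connes_def connes_term_def)

lemma connes_term_eq: "connes_term (a, gs) = lin_ext unit_tuple (cyc_norm (a # gs))"
proof -
  have "rotate i (a # gs) = drop i (a # gs) @ take i (a # gs)" if "i \<le> length gs" for i
    using that by (simp add: rotate_drop_take)
  then show ?thesis
    by (auto intro!: sum.cong simp: connes_term_def cyc_norm_def lin_ext_linear sgn_rot_def unit_tuple_def
        Let_def atLeast0AtMost lessThan_Suc_atMost)
qed

lemma unit_tuple_degenerate: "\<one> \<in> set w \<Longrightarrow> unit_tuple w = 0"
  by (simp add: unit_tuple_def hoch_tuple_def)

lemma connes_cyc_tuple:
  assumes "w \<noteq> []"
  shows "connes G (cyc_tuple w :: _ \<Rightarrow>\<^sub>0 'k::field) = lin_ext unit_tuple (cyc_norm w)"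
proof (cases "\<one> \<in> set (tl w)")
  case True
  then have "\<one> \<in> set w"
    using assms by (cases w) auto
  then have "lin_ext unit_tuple (cyc_norm w) = (0 :: _ \<Rightarrow>\<^sub>0 'k)"
    by (simp add: cyc_norm_def sgn_rot_def lin_ext_linear unit_tuple_degenerate)
  then show ?thesis
    using True by (simp add: cyc_tuple_def hoch_tuple_def connes_eq)
next
  case False
  then show ?thesis
    using assms by (simp add: cyc_tuple_def hoch_tuple_def connes_eq connes_term_eq)
qed

text \<open>
  The identity \<open>b \<circ> s = 1 - \<tau>\<^bsup>-1\<^esup> - s \<circ> b'\<close> for the extra degeneracy \<open>s\<close>: the first and last faces of \<open>(1, w)\<close>
  multiply the unit into the first and last letters of \<open>w\<close>.
\<close>

lemma hoch_boundary_unit_tuple: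
  assumes "set w \<subseteq> carrier G" "w \<noteq> []"
  shows "hoch_boundary G (unit_tuple w :: _ \<Rightarrow>\<^sub>0 'k::field)
     = cyc_tuple w - lin_ext cyc_tuple (sgn_rot (length w - 1) w) - lin_ext unit_tuple (inner_faces G w)"
proof -
  obtain p l where w: "w = p @ [l]"
    using assms by (cases w rule: rev_cases) auto
  have l: "l \<in> carrier G" "hd w \<in> carrier G"
    using assms hd_in_set[of w] by (auto simp: w)
  have "rotate (length p) w = l # p"
    using rotate_append[of p "[l]"] by (simp add: w)
  moreover have "(-1::'k) ^ (length p * length p) = (-1) ^ length p"
    by (simp add: minus_one_power_iff)
  ultimately have rot: "lin_ext cyc_tuple (sgn_rot (length w - 1) w)
      = scale ((-1) ^ length p) (hoch_tuple G (l, p) :: _ \<Rightarrow>\<^sub>0 'k)"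
    by (simp add: sgn_rot_def lin_ext_linear cyc_tuple_def w)
  have "(\<Sum>i=1..length p. scale ((-1)^i) (hoch_tuple G (\<one>, merge G i w) :: _ \<Rightarrow>\<^sub>0 'k))
      = (\<Sum>i<length p. - scale ((-1)^i) (unit_tuple (merge G (Suc i) w)))"
    by (rule sum.reindex_bij_witness[of _ Suc "\<lambda>i. i - 1"])
       (auto simp: unit_tuple_def gr0_conv_Suc Suc_le_eq)
  then have "(\<Sum>i=1..length p. scale ((-1)^i) (hoch_tuple G (\<one>, merge G i w) :: _ \<Rightarrow>\<^sub>0 'k))
      = - lin_ext unit_tuple (inner_faces G w)"
    by (simp add: inner_faces_def lin_ext_linear sum_negf w)
  then have "(hoch_faces (\<one>, w) :: _ \<Rightarrow>\<^sub>0 'k) = cyc_tuple w - lin_ext cyc_tuple (sgn_rot (length w - 1) w)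
      - lin_ext unit_tuple (inner_faces G w)"
    unfolding rot using l by (simp add: hoch_faces_def Let_def cyc_tuple_def w)
  then show ?thesis
    using assms by (simp add: unit_tuple_def hoch_boundary_hoch_tuple)
qed

text \<open>
  As \<open>B = s \<circ> N\<close> and \<open>(1 - \<tau>\<^bsup>-1\<^esup>) \<circ> N = 0\<close>, it follows that \<open>b \<circ> B = - s \<circ> b' \<circ> N = - s \<circ> N \<circ> b = - B \<circ> b\<close>.
\<close>

lemma hoch_boundary_connes_term:
  assumes "a \<in> carrier G" "set gs \<subseteq> carrier G"
  shows "hoch_boundary G (connes_term (a, gs) :: _ \<Rightarrow>\<^sub>0 'k::field) = - connes G (hoch_faces (a, gs))"
proof -
  let ?w = "a # gs" let ?n = "length gs"
  have supp: "(cyc_norm ?w :: _ \<Rightarrow>\<^sub>0 'k) \<in> free_on {v. set v \<subseteq> carrier G \<and> length v = Suc ?n}"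
    unfolding cyc_norm_def sgn_rot_def using assms
    by (intro free_on_sum free_on_scale free_on_bas) auto
  have "hoch_boundary G (connes_term (a, gs) :: _ \<Rightarrow>\<^sub>0 'k)
     = lin_ext (\<lambda>w. hoch_boundary G (unit_tuple w)) (cyc_norm ?w)"
    by (simp add: connes_term_eq hoch_boundary_eq lin_ext_comp)
  also have "\<dots> = lin_ext (\<lambda>w. cyc_tuple w - lin_ext cyc_tuple (sgn_rot ?n w)
        - lin_ext unit_tuple (inner_faces G w)) (cyc_norm ?w)"
    using supp by (rule lin_ext_cong_on) (subst hoch_boundary_unit_tuple, auto)
  also have "\<dots> = lin_ext cyc_tuple (cyc_norm ?w)
       - lin_ext cyc_tuple (lin_ext (sgn_rot ?n) (cyc_norm ?w))
       - lin_ext unit_tuple (lin_ext (inner_faces G) (cyc_norm ?w))"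
    by (simp add: lin_ext_diff_fun lin_ext_comp)
  also have "\<dots> = - lin_ext unit_tuple (lin_ext cyc_norm (cyc_faces G ?w))"
    by (simp add: sgn_rot_cyc_norm cyc_norm_cyc_faces)
  also have "lin_ext unit_tuple (lin_ext cyc_norm (cyc_faces G ?w :: _ \<Rightarrow>\<^sub>0 'k))
     = lin_ext (\<lambda>v. connes G (cyc_tuple v)) (cyc_faces G ?w)"
  proof -
    have "(cyc_faces G ?w :: _ \<Rightarrow>\<^sub>0 'k) \<in> free_on {v. v \<noteq> []}"
      unfolding cyc_faces_def inner_faces_def merge_def
      by (auto intro!: free_on_zero free_on_add free_on_sum free_on_scale free_on_bas)
    then show ?thesis
      unfolding lin_ext_comp by (rule lin_ext_cong_on) (simp add: connes_cyc_tuple)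
  qed
  also have "\<dots> = connes G (hoch_faces (a, gs))"
    by (simp add: hoch_faces_eq_cyc_faces connes_eq lin_ext_comp)
  finally show ?thesis .
qed

lemma hoch_boundary_connes:
  assumes "p \<in> hoch_chains G n"
  shows "hoch_boundary G (connes G p) = - connes G (hoch_boundary G p)"
proof -
  have "hoch_boundary G (connes G p) = lin_ext (\<lambda>t. hoch_boundary G (connes_term t)) p"
    by (simp add: connes_eq hoch_boundary_eq lin_ext_comp)
  also have "\<dots> = lin_ext (\<lambda>t. - connes G (hoch_faces t)) p"
    using assms unfolding hoch_chains_def
    by (rule lin_ext_cong_on) (clarsimp simp: nontriv_tuples_def, subst hoch_boundary_connes_term, auto)
  also have "\<dots> = - connes G (hoch_boundary G p)"
    by (simp add: connes_eq hoch_boundary_eq lin_ext_comp lin_ext_minus_fun)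
  finally show ?thesis .
qed

end

section \<open>The prism of a right transversal\<close>

locale right_transversal = group G for G :: "('a, 'm) monoid_scheme" (structure) +
  fixes H T :: "'a set"
  assumes subgroup_H: "subgroup H G"
    and reps_T: "right_coset_reps G H T"
    and one_in_T: "\<one> \<in> T"
begin

abbreviation rep :: "'a \<Rightarrow> 'a" where
  "rep \<equiv> coset_rep G H T"

abbreviation walk :: "'a \<Rightarrow> 'a list \<Rightarrow> 'a list" where
  "walk \<equiv> coset_walk G H T"

text \<open>
  For \<open>t\<close> in the transversal, \<open>t g\<close> factors uniquely as an element of \<open>H\<close> times a representative. The
  \<open>H\<close>-component is a functor from the action groupoid of \<open>G\<close> on the right cosets of \<open>H\<close> to \<open>H\<close>: it respects composition
  (\<open>cocycle_mult\<close>) and units (\<open>cocycle_one\<close>). A coset walk applies it to each arrow of a path.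
\<close>

definition cocycle :: "'a \<Rightarrow> 'a \<Rightarrow> 'a" where
  "cocycle t g = t \<otimes> g \<otimes> inv (rep (t \<otimes> g))"

lemma T_carrier: "t \<in> T \<Longrightarrow> t \<in> carrier G"
  using reps_T by (auto simp: right_coset_reps_def)

lemma H_carrier: "h \<in> H \<Longrightarrow> h \<in> carrier G"
  using subgroup.subset[OF subgroup_H] by auto

lemma in_coset_iff:
  assumes "g \<in> carrier G" "t \<in> carrier G"
  shows "g \<in> H #> t \<longleftrightarrow> g \<otimes> inv t \<in> H"
proof
  assume "g \<in> H #> t"
  then obtain h where "h \<in> H" "g = h \<otimes> t"
    by (auto simp: r_coset_def)
  then show "g \<otimes> inv t \<in> H"
    using assms H_carrier by (simp add: m_assoc)
next
  assume *: "g \<otimes> inv t \<in> H"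
  have "g = (g \<otimes> inv t) \<otimes> t"
    using assms by (simp add: m_assoc)
  then show "g \<in> H #> t"
    using * unfolding r_coset_def by blast
qed

lemma ex1_rep:
  assumes "g \<in> carrier G"
  shows "\<exists>!t. t \<in> T \<and> g \<in> H #> t"
proof -
  have "H #> g \<in> rcosets H"
    using assms subgroup.subset[OF subgroup_H] by (simp add: rcosetsI)
  then have "\<exists>!t. t \<in> T \<and> t \<in> H #> g"
    using reps_T unfolding right_coset_reps_def by blast
  moreover have "t \<in> H #> g \<longleftrightarrow> g \<in> H #> t" if "t \<in> T" for t
    using repr_independence[OF _ _ subgroup_H] rcos_self[OF _ subgroup_H] assms T_carrier[OF that]
    by metis
  ultimately show ?thesis
    by (simp cong: conj_cong)
qed

lemma rep_in_T: "g \<in> carrier G \<Longrightarrow> rep g \<in> T"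
  and rep_quotient: "g \<in> carrier G \<Longrightarrow> g \<otimes> inv (rep g) \<in> H"
  using theI'[OF ex1_rep, of g] T_carrier by (auto simp: coset_rep_def in_coset_iff)

lemma rep_closed [simp]: "g \<in> carrier G \<Longrightarrow> rep g \<in> carrier G"
  using rep_in_T T_carrier by blast

lemma rep_eqI: "t \<in> T \<Longrightarrow> g \<in> carrier G \<Longrightarrow> g \<otimes> inv t \<in> H \<Longrightarrow> rep g = t"
  unfolding coset_rep_def using ex1_rep[of g] T_carrier in_coset_iff by (intro the1_equality) auto

lemma rep_T: "t \<in> T \<Longrightarrow> rep t = t"
  using subgroup.one_closed[OF subgroup_H] T_carrier by (intro rep_eqI) auto

lemma rep_H: "h \<in> H \<Longrightarrow> rep h = \<one>"
  using H_carrier one_in_T by (intro rep_eqI) auto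

lemma rep_rep_mult:
  assumes "a \<in> carrier G" "g \<in> carrier G"
  shows "rep (rep a \<otimes> g) = rep (a \<otimes> g)"
proof (rule rep_eqI)
  let ?b = "rep (a \<otimes> g)"
  have "inv (a \<otimes> inv (rep a)) \<in> H" "a \<otimes> g \<otimes> inv ?b \<in> H"
    using assms rep_quotient subgroup.m_inv_closed[OF subgroup_H] by auto
  then have "inv (a \<otimes> inv (rep a)) \<otimes> (a \<otimes> g \<otimes> inv ?b) \<in> H"
    by (rule subgroup.m_closed[OF subgroup_H])
  moreover have "inv (a \<otimes> inv (rep a)) \<otimes> (a \<otimes> g \<otimes> inv ?b) = rep a \<otimes> g \<otimes> inv ?b"
    using assms by (simp add: inv_mult_group m_assoc inv_solve_left')
  ultimately show "rep a \<otimes> g \<otimes> inv ?b \<in> H"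
    by simp
qed (use assms rep_in_T in auto)

lemma cocycle_in_H: "t \<in> T \<Longrightarrow> g \<in> carrier G \<Longrightarrow> cocycle t g \<in> H"
  using rep_quotient[of "t \<otimes> g"] T_carrier by (simp add: cocycle_def)

lemma cocycle_closed: "t \<in> T \<Longrightarrow> g \<in> carrier G \<Longrightarrow> cocycle t g \<in> carrier G"
  using cocycle_in_H H_carrier by blast

lemma cocycle_mult_rep:
  "t \<in> T \<Longrightarrow> g \<in> carrier G \<Longrightarrow> cocycle t g \<otimes> rep (t \<otimes> g) = t \<otimes> g"
  using T_carrier by (simp add: cocycle_def m_assoc)

lemma cocycle_mult:
  assumes "t \<in> T" "g \<in> carrier G" "h \<in> carrier G"
  shows "cocycle t g \<otimes> cocycle (rep (t \<otimes> g)) h = cocycle t (g \<otimes> h)"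
proof -
  have t: "t \<in> carrier G"
    using assms T_carrier by blast
  have "cocycle t g \<otimes> cocycle (rep (t \<otimes> g)) h
      = cocycle t g \<otimes> rep (t \<otimes> g) \<otimes> h \<otimes> inv (rep (rep (t \<otimes> g) \<otimes> h))"
    using assms t cocycle_closed by (simp add: cocycle_def[of "rep (t \<otimes> g)"] m_assoc)
  also have "\<dots> = cocycle t (g \<otimes> h)"
    using assms t by (simp add: cocycle_mult_rep rep_rep_mult cocycle_def m_assoc)
  finally show ?thesis .
qed

lemma cocycle_one: "t \<in> T \<Longrightarrow> cocycle t \<one> = \<one>"
  using T_carrier by (simp add: cocycle_def rep_T)

lemma walk_Cons: "walk t (g # gs) = cocycle t g # walk (rep (t \<otimes> g)) gs"
  by (simp add: Let_def cocycle_def)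

declare coset_walk.simps(2) [simp del]

lemma walk_in_H:
  "t \<in> T \<Longrightarrow> set gs \<subseteq> carrier G \<Longrightarrow> set (walk t gs) \<subseteq> H \<and> length (walk t gs) = length gs"
  by (induction gs arbitrary: t) (auto simp: walk_Cons cocycle_in_H rep_in_T T_carrier)

lemma walk_degenerate:
  "t \<in> T \<Longrightarrow> set gs \<subseteq> carrier G \<Longrightarrow> \<one> \<in> set gs \<Longrightarrow> \<one> \<in> set (walk t gs)"
  by (induction gs arbitrary: t) (auto simp: walk_Cons cocycle_one rep_in_T T_carrier)

lemma walk_one: "set hs \<subseteq> H \<Longrightarrow> walk \<one> hs = hs"
  by (induction hs) (auto simp: walk_Cons cocycle_def rep_H H_carrier)

text \<open>
  Functoriality of the cocycle, applied to the first two arrows of a path.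
\<close>

lemma head_mult_walk:
  assumes "t \<in> T" "g \<in> carrier G" "set w \<subseteq> carrier G"
  shows "head_mult G (cocycle t g) (walk (rep (t \<otimes> g)) w) = walk t (head_mult G g w)"
proof (cases w)
  case (Cons h v)
  then show ?thesis
    using assms T_carrier[of t] by (simp add: walk_Cons cocycle_mult rep_rep_mult m_assoc)
qed simp

lemma bar_tail_walk:
  assumes "t \<in> T" "set gs \<subseteq> carrier G"
  shows "bar_tail G (walk t gs) = lin_ext (\<lambda>w. bas (walk t w)) (bar_tail G gs)"
  using assms
proof (induction gs arbitrary: t)
  case (Cons g gs)
  then show ?case
    using T_carrier[of t]
    by (simp add: walk_Cons head_mult_walk lin_ext_linear lin_ext_push push_lin_ext rep_in_T)
qed simp

text \<open>
  The prism over a path \<open>g\<^sub>1, \<dots>, g\<^sub>n\<close> of the coset groupoid that starts at the coset of \<open>t\<close> is the alternating sum over \<open>j\<close>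
  of the paths that follow the first \<open>j\<close> steps of the walk in \<open>H\<close>, cross over by a representative, and then
  follow \<open>g\<^bsub>j+1\<^esub>, \<dots>, g\<^sub>n\<close>. The recursion splits off the summand that crosses at once.
\<close>

primrec prism :: "'a \<Rightarrow> 'a list \<Rightarrow> ('a list \<Rightarrow>\<^sub>0 'k::field)" where
  "prism t [] = bas [t]"
| "prism t (g # gs) = bas (t # g # gs) - push (cocycle t g) (prism (rep (t \<otimes> g)) gs)"

text \<open>
  Multiplying the first step of the walk into the prism over the remaining path. Both faces adjacent to
  the crossing yield the same diagonal \<open>t g\<close>; the other terms compare the prism with the prism over the
  path whose first two arrows have been composed.
\<close>

lemma head_mult_prism:
  assumes "t \<in> T" "g \<in> carrier G" "set gs \<subseteq> carrier G"
  shows "lin_ext (\<lambda>w. bas (head_mult G (cocycle t g) w)) (prism (rep (t \<otimes> g)) gs)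
     = bas ((t \<otimes> g) # gs) + prism t (head_mult G g gs) - bas (t # head_mult G g gs)"
proof (cases gs)
  case Nil
  then show ?thesis
    using assms by (simp add: cocycle_mult_rep)
next
  case (Cons h w)
  then show ?thesis
    using assms T_carrier[of t]
    by (simp add: cocycle_mult_rep cocycle_mult rep_rep_mult lin_ext_linear lin_ext_comp m_assoc push_def)
qed

text \<open>
  The part of the homotopy identity that comes from the faces of positive index. Writing \<open>d'\<close> for
  \<open>bar_tail\<close> and \<open>P\<close> for the prism, \<open>d' P + P d'\<close> collects the faces along the interior and the far end of the
  prism: the interior ones cancel, and the last face of the last summand leaves minus the walk. The zeroth faces
  are treated in \<open>first_faces_prism\<close>, since they depend on the starting vertex.
\<close>

lemma prism_homotopy:
  assumes "t \<in> T" "set gs \<subseteq> carrier G"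
  shows "lin_ext (bar_tail G) (prism t gs) + lin_ext (prism t) (bar_tail G gs)
     = - (bas (walk t gs) :: 'a list \<Rightarrow>\<^sub>0 'k::field)"
  using assms
proof (induction gs arbitrary: t)
  case (Cons g gs)
  \<comment> \<open>With \<open>y\<close> the prism over the remaining path, both halves unfold to terms that cancel by \<open>head_mult_prism\<close>, up to the induction hypothesis with \<open>cocycle t g\<close> in front.\<close>
  let ?F = "cocycle t g" and ?t = "rep (t \<otimes> g)"
  let ?y = "prism ?t gs :: 'a list \<Rightarrow>\<^sub>0 'k"
  have t: "t \<in> carrier G" "?t \<in> T"
    using Cons.prems T_carrier rep_in_T by auto
  have left: "lin_ext (bar_tail G) (prism t (g # gs))
      = - bas ((t \<otimes> g) # gs) - push t (bar_tail G (g # gs))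
        + lin_ext (\<lambda>w. bas (head_mult G ?F w)) ?y + push ?F (lin_ext (bar_tail G) ?y)"
    by (simp add: lin_ext_linear lin_ext_push lin_ext_diff_fun lin_ext_minus_fun push_lin_ext)
  have right: "lin_ext (prism t) (bar_tail G (g # gs))
      = - prism t (head_mult G g gs) - push t (push g (bar_tail G gs))
        + push ?F (lin_ext (prism ?t) (bar_tail G gs))"
    by (simp add: lin_ext_linear lin_ext_push lin_ext_diff_fun push_lin_ext push_def lin_ext_comp)
  have "lin_ext (bar_tail G) (prism t (g # gs)) + lin_ext (prism t) (bar_tail G (g # gs))
      = push ?F (lin_ext (bar_tail G) ?y + lin_ext (prism ?t) (bar_tail G gs))"
    unfolding left right using Cons.prems by (simp add: head_mult_prism push_linear)
  also have "\<dots> = - bas (walk t (g # gs))"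
    using Cons.IH[of ?t] Cons.prems t by (simp add: push_linear walk_Cons)
  finally show ?case .
qed simp

lemma prism_closed:
  assumes "t \<in> T" "set gs \<subseteq> carrier G"
  shows "(prism t gs :: 'a list \<Rightarrow>\<^sub>0 'k::field) \<in> free_on {w. set w \<subseteq> carrier G \<and> length w = Suc (length gs)}"
  using assms
proof (induction gs arbitrary: t)
  case Nil
  then show ?case
    by (auto intro!: free_on_bas simp: T_carrier)
next
  case (Cons g gs)
  let ?S = "{w. set w \<subseteq> carrier G \<and> length w = Suc (length (g # gs))}"
  have t: "t \<in> carrier G" "rep (t \<otimes> g) \<in> T" "cocycle t g \<in> carrier G"
    using Cons.prems T_carrier rep_in_T cocycle_closed by auto
  have "(bas (t # g # gs) :: 'a list \<Rightarrow>\<^sub>0 'k) \<in> free_on ?S"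
    using Cons.prems t by (intro free_on_bas) auto
  moreover have "(push (cocycle t g) (prism (rep (t \<otimes> g)) gs) :: 'a list \<Rightarrow>\<^sub>0 'k) \<in> free_on ?S"
    unfolding push_def
  proof (rule lin_ext_in_free_on[OF Cons.IH])
    show "rep (t \<otimes> g) \<in> T" "set gs \<subseteq> carrier G"
      using Cons.prems t by auto
  qed (rule free_on_bas, use t in auto)
  ultimately show ?case
    by (simp add: free_on_diff)
qed

lemma prism_degenerate:
  assumes "t \<in> T" "set gs \<subseteq> carrier G" "\<one> \<in> set gs" "\<And>w. \<one> \<in> set w \<Longrightarrow> f w = 0"
  shows "lin_ext f (prism t gs) = 0"
  using assms
proof (induction gs arbitrary: t f)
  case (Cons g gs)
  have "lin_ext (\<lambda>w. f (cocycle t g # w)) (prism (rep (t \<otimes> g)) gs) = 0"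
  proof (cases "g = \<one>")
    case True
    then show ?thesis
      using Cons.prems by (simp add: cocycle_one)
  next
    case False
    then show ?thesis
      using Cons.prems T_carrier by (intro Cons.IH) (auto intro: rep_in_T)
  qed
  moreover have "f (t # g # gs) = 0"
    using Cons.prems by auto
  ultimately show ?case
    by (simp add: lin_ext_linear lin_ext_push)
qed simp

end

section \<open>The summand of a conjugacy class and group chains of the centralizer\<close>

lemma (in group) subgroup_centralizer:
  assumes "x \<in> carrier G"
  shows "subgroup (centralizer G x) G"
proof
  fix g h assume "g \<in> centralizer G x" "h \<in> centralizer G x"
  then have gh: "g \<in> carrier G" "h \<in> carrier G" "g \<otimes> x = x \<otimes> g" "h \<otimes> x = x \<otimes> h"
    by (auto simp: centralizer_def)
  then have "g \<otimes> h \<otimes> x = x \<otimes> (g \<otimes> h)"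
    using assms by (metis m_assoc)
  then show "g \<otimes> h \<in> centralizer G x"
    using gh by (simp add: centralizer_def)
next
  fix g assume "g \<in> centralizer G x"
  then have g: "g \<in> carrier G" "g \<otimes> x = x \<otimes> g"
    by (auto simp: centralizer_def)
  then have "inv g \<otimes> x = inv g \<otimes> (x \<otimes> g) \<otimes> inv g"
    using assms by (simp add: m_assoc)
  also have "\<dots> = x \<otimes> inv g"
    using assms g(1) by (simp add: g(2)[symmetric] m_assoc[symmetric])
  finally show "inv g \<in> centralizer G x"
    using g by (simp add: centralizer_def)
qed (use assms in \<open>auto simp: centralizer_def\<close>)

text \<open>
  From here on \<open>H\<close> is the centralizer of \<open>x\<close>. Its right cosets correspond to the conjugates of \<open>x\<close> by
  \<open>g \<mapsto> g\<inverse> x g\<close>, so the coset groupoid of the previous section becomes the component of \<open>x\<close> in the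
  conjugation groupoid.
\<close>

locale centralizer_transversal = group G for G :: "('a, 'm) monoid_scheme" (structure) +
  fixes x :: 'a and T :: "'a set"
  assumes x_closed [simp]: "x \<in> carrier G"
    and reps: "right_coset_reps G (centralizer G x) T"
    and one_rep: "\<one> \<in> T"
begin

sublocale right_transversal G "centralizer G x" T
  by (intro right_transversal.intro right_transversal_axioms.intro group_axioms
      subgroup_centralizer x_closed reps one_rep)

abbreviation C :: "('a, 'm) monoid_scheme" where
  "C \<equiv> centralizer_group G x"

definition conj_by :: "'a \<Rightarrow> 'a" where
  "conj_by g = inv g \<otimes> x \<otimes> g"

lemma conj_by_closed [simp]: "g \<in> carrier G \<Longrightarrow> conj_by g \<in> carrier G"
  by (simp add: conj_by_def)

lemma conj_by_one [simp]: "conj_by \<one> = x"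
  by (simp add: conj_by_def)

lemma conj_by_mult:
  "g \<in> carrier G \<Longrightarrow> h \<in> carrier G \<Longrightarrow> conj_by (g \<otimes> h) = inv h \<otimes> conj_by g \<otimes> h"
  by (simp add: conj_by_def inv_mult_group m_assoc)

lemma centralizer_iff: "g \<in> centralizer G x \<longleftrightarrow> g \<in> carrier G \<and> conj_by g = x"
proof -
  have "g \<otimes> x = x \<otimes> g \<longleftrightarrow> inv g \<otimes> x \<otimes> g = x" if g: "g \<in> carrier G"
  proof
    assume "g \<otimes> x = x \<otimes> g"
    then have "inv g \<otimes> (x \<otimes> g) = inv g \<otimes> (g \<otimes> x)"
      by simp
    then show "inv g \<otimes> x \<otimes> g = x"
      using g by (simp add: m_assoc[symmetric])
  next
    assume "inv g \<otimes> x \<otimes> g = x"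
    then have "g \<otimes> (inv g \<otimes> x \<otimes> g) = g \<otimes> x"
      by simp
    then show "g \<otimes> x = x \<otimes> g"
      using g by (simp add: m_assoc[symmetric])
  qed
  then show ?thesis
    by (auto simp: centralizer_def conj_by_def)
qed

lemma conj_by_eq_iff:
  assumes "g \<in> carrier G" "h \<in> carrier G"
  shows "conj_by g = conj_by h \<longleftrightarrow> g \<otimes> inv h \<in> centralizer G x"
proof -
  have "conj_by (g \<otimes> inv h) = x \<longleftrightarrow> conj_by g = conj_by h"
  proof
    assume "conj_by (g \<otimes> inv h) = x"
    then have "conj_by (g \<otimes> inv h \<otimes> h) = conj_by h"
      using assms by (subst conj_by_mult) (simp_all add: conj_by_def[of h])
    then show "conj_by g = conj_by h"
      using assms by (simp add: m_assoc)
  next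
    assume *: "conj_by g = conj_by h"
    have "conj_by (g \<otimes> inv h) = conj_by (h \<otimes> inv h)"
      using assms by (simp only: conj_by_mult inv_closed *)
    then show "conj_by (g \<otimes> inv h) = x"
      using assms by simp
  qed
  then show ?thesis
    using assms by (simp add: centralizer_iff)
qed

lemma conj_by_rep: "g \<in> carrier G \<Longrightarrow> conj_by (rep g) = conj_by g"
  using rep_quotient by (metis conj_by_eq_iff rep_closed)

lemma conj_class_eq: "conj_class G x = conj_by ` T"
proof
  show "conj_class G x \<subseteq> conj_by ` T"
  proof
    fix u assume "u \<in> conj_class G x"
    then obtain g where "g \<in> carrier G" "u = conj_by g"
      by (auto simp: conj_class_def conj_by_def)
    then show "u \<in> conj_by ` T"
      using conj_by_rep[of g] rep_in_T[of g] by (metis imageI)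
  qed
qed (use T_carrier in \<open>auto simp: conj_class_def conj_by_def\<close>)

lemma conj_by_in_class: "g \<in> carrier G \<Longrightarrow> conj_by g \<in> conj_class G x"
  by (auto simp: conj_class_def conj_by_def)

lemma conj_class_conjugate:
  "u \<in> conj_class G x \<Longrightarrow> g \<in> carrier G \<Longrightarrow> inv g \<otimes> u \<otimes> g \<in> conj_class G x"
  using conj_by_mult conj_by_in_class T_carrier by (auto simp: conj_class_eq) (metis m_closed)

subsection \<open>Chains\<close>

definition class_tuples :: "nat \<Rightarrow> ('a \<times> 'a list) set" where
  "class_tuples n = {(inv_twist G gs u, gs) | u gs. u \<in> conj_class G x \<and> gs \<in> nontriv_tuples G n}"

lemma class_chains_eq: "class_chains G x n = free_on (class_tuples n)"
  by (simp add: class_chains_def class_tuples_def)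

text \<open>
  Every vertex of the component is \<open>t\<inverse> x t\<close> for a representative \<open>t\<close>, so chain identities on the summand need
  to be checked only on paths that start at such vertices.
\<close>

lemma class_tuplesE:
  assumes "v \<in> class_tuples n"
  obtains t gs where "t \<in> T" "set gs \<subseteq> carrier G" "\<one> \<notin> set gs" "length gs = n"
    "v = (inv_twist G gs (conj_by t), gs)"
  using assms by (auto simp: class_tuples_def conj_class_eq nontriv_tuples_def)

lemma class_chains_subset: "class_chains G x n \<subseteq> hoch_chains G n"
proof -
  have "class_tuples n \<subseteq> carrier G \<times> nontriv_tuples G n"
  proof
    fix v assume "v \<in> class_tuples n"
    then show "v \<in> carrier G \<times> nontriv_tuples G n"
      by (rule class_tuplesE) (auto simp: nontriv_tuples_def inv_twist_closed T_carrier)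
  qed
  then show ?thesis
    unfolding class_chains_eq hoch_chains_def using free_on_mono by blast
qed

lemma arrow_in_class_chains:
  assumes "u \<in> conj_class G x" "set gs \<subseteq> carrier G" "length gs = n"
  shows "arrow u gs \<in> class_chains G x n"
proof (cases "\<one> \<in> set gs")
  case False
  then have "(inv_twist G gs u, gs) \<in> class_tuples n"
    using assms by (auto simp: class_tuples_def nontriv_tuples_def)
  then show ?thesis
    using False by (simp add: arrow_def hoch_tuple_def class_chains_eq free_on_bas)
qed (simp add: arrow_degenerate class_chains_eq free_on_zero)

lemma centralizer_group_simps:
  "carrier C = centralizer G x" "\<one>\<^bsub>C\<^esub> = \<one>" "grp_tuple C = grp_tuple G" "merge C = merge G"
  by (simp_all add: centralizer_group_def grp_tuple_def merge_def fun_eq_iff)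

lemma grp_tuple_degenerate: "\<one> \<in> set w \<Longrightarrow> grp_tuple G w = 0"
  by (simp add: grp_tuple_def)

lemma grp_tuple_in_chains:
  assumes "set w \<subseteq> centralizer G x" "length w = n"
  shows "grp_tuple G w \<in> grp_chains C n"
  using assms
  by (auto simp: grp_tuple_def grp_chains_def nontriv_tuples_def centralizer_group_simps
      intro!: free_on_zero free_on_bas)

lemma grp_boundary_grp_tuple_Nil: "grp_boundary C (grp_tuple G []) = 0"
  by (simp add: grp_tuple_def grp_boundary_def)

lemma grp_boundary_grp_tuple_Cons:
  assumes "set (h # hs) \<subseteq> centralizer G x"
  shows "grp_boundary C (grp_tuple G (h # hs) :: _ \<Rightarrow>\<^sub>0 'k::field)
     = grp_tuple G hs + lin_ext (grp_tuple G) (bar_tail G (h # hs))"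
proof (cases "\<one> \<in> set (h # hs)")
  case True
  have "set (h # hs) \<subseteq> carrier G"
    using assms H_carrier by auto
  then have "lin_ext (grp_tuple G) (bar_tail G (h # hs)) = (if h = \<one> then - (grp_tuple G hs :: _ \<Rightarrow>\<^sub>0 'k) else 0)"
    using True by (subst bar_tail_degenerate) (auto simp: grp_tuple_degenerate)
  then show ?thesis
    using True by (auto simp: grp_tuple_degenerate grp_boundary_def simp del: bar_tail.simps)
next
  case False
  then show ?thesis
    by (simp add: grp_tuple_def[of G "h # hs"] grp_boundary_def centralizer_group_simps
        lin_ext_bar_tail add.assoc del: bar_tail.simps)
qed

subsection \<open>The maps \<open>\<iota>\<close> and \<open>\<rho>\<close>\<close>

lemma iota_eq: "iota G x = lin_ext (arrow x)"
  by (simp add: iota_def arrow_def[abs_def])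

lemma iota_grp_tuple: "iota G x (grp_tuple G w) = arrow x w"
  by (simp add: iota_eq grp_tuple_def arrow_degenerate)

lemma iota_lin_ext_grp_tuple: "iota G x (lin_ext (grp_tuple G) p) = lin_ext (arrow x) p"
  by (simp add: iota_eq lin_ext_comp iota_grp_tuple[unfolded iota_eq])

lemma nontriv_centralizerD:
  "w \<in> nontriv_tuples C n \<Longrightarrow> set w \<subseteq> centralizer G x \<and> \<one> \<notin> set w \<and> length w = n"
  by (auto simp: nontriv_tuples_def centralizer_group_simps)

lemma iota_closed:
  assumes "p \<in> grp_chains C n"
  shows "iota G x p \<in> class_chains G x n"
  using assms unfolding iota_eq grp_chains_def class_chains_eq
  by (rule lin_ext_in_free_on)
     (use nontriv_centralizerD H_carrier conj_by_in_class[of \<one>] in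
       \<open>force intro: arrow_in_class_chains[unfolded class_chains_eq]\<close>)

text \<open>
  A loop moves the starting vertex \<open>x\<close> to itself, so the zeroth face of the path of loops is again a path at \<open>x\<close>.
\<close>

lemma iota_boundary:
  fixes p :: "_ \<Rightarrow>\<^sub>0 'k::field"
  assumes "p \<in> grp_chains C n"
  shows "hoch_boundary G (iota G x p) = iota G x (grp_boundary C p)"
proof -
  have "hoch_boundary G (arrow x w) = iota G x (grp_boundary C (bas w :: _ \<Rightarrow>\<^sub>0 'k))"
    if "w \<in> nontriv_tuples C n" for w
  proof -
    have w: "set w \<subseteq> centralizer G x" "grp_tuple G w = (bas w :: _ \<Rightarrow>\<^sub>0 'k)"
      using nontriv_centralizerD[OF that] by (auto simp: grp_tuple_def)
    show ?thesis
    proof (cases w)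
      case Nil
      then show ?thesis
        using w(2)[symmetric]
        by (simp add: hoch_boundary_arrow_Nil iota_eq grp_boundary_grp_tuple_Nil)
    next
      case (Cons h hs)
      have "set (h # hs) \<subseteq> carrier G" "inv h \<otimes> x \<otimes> h = x"
        using w H_carrier centralizer_iff[of h] by (auto simp: Cons conj_by_def)
      then have "hoch_boundary G (arrow x w) = (arrow x hs :: _ \<Rightarrow>\<^sub>0 'k) + lin_ext (arrow x) (bar_tail G w)"
        using hoch_boundary_arrow_Cons[of x h hs] by (simp add: Cons del: bar_tail.simps)
      also have "\<dots> = iota G x (grp_boundary C (grp_tuple G w))"
        using w(1) by (simp add: Cons grp_boundary_grp_tuple_Cons iota_eq lin_ext_add
            iota_lin_ext_grp_tuple[unfolded iota_eq] iota_grp_tuple[unfolded iota_eq] del: bar_tail.simps)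
      finally show ?thesis
        using w by simp
    qed
  qed
  then show ?thesis
    using assms unfolding iota_eq grp_chains_def
    by (subst lin_ext_bas_id[of p, symmetric])
       (auto simp: hoch_boundary_eq grp_boundary_def lin_ext_comp intro: lin_ext_cong_on)
qed

definition rho_term :: "'a \<times> 'a list \<Rightarrow> ('a list \<Rightarrow>\<^sub>0 'k::field)" where
  "rho_term = (\<lambda>(a, gs).
     let g0 = (SOME g. g \<in> carrier G \<and> a = inv_twist G gs (inv g \<otimes> x \<otimes> g))
     in grp_tuple G (walk (rep g0) gs))"

lemma rho_eq: "rho G T x = lin_ext rho_term"
  by (simp add: rho_def rho_term_def)

lemma inv_twist_inject:
  assumes "set gs \<subseteq> carrier G" "u \<in> carrier G" "v \<in> carrier G"
  shows "inv_twist G gs u = inv_twist G gs v \<longleftrightarrow> u = v"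
  using assms word_prod_inv_twist by metis

text \<open>
  Any two choices of \<open>g\<^sub>0\<close> differ by an element of the centralizer on the left and have the same
  representative, namely \<open>t\<close>.
\<close>

lemma rho_term_arrow:
  assumes "t \<in> T" "set gs \<subseteq> carrier G"
  shows "rho_term (inv_twist G gs (conj_by t), gs) = grp_tuple G (walk t gs)"
proof -
  let ?P = "\<lambda>g. g \<in> carrier G \<and> inv_twist G gs (conj_by t) = inv_twist G gs (inv g \<otimes> x \<otimes> g)"
  define g0 where "g0 = (SOME g. ?P g)"
  have "?P t"
    using assms T_carrier by (simp add: conj_by_def)
  then have "?P g0"
    unfolding g0_def by (rule someI)
  then have g0: "g0 \<in> carrier G" "inv_twist G gs (conj_by t) = inv_twist G gs (conj_by g0)"
    by (simp_all add: conj_by_def)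
  then have "conj_by g0 = conj_by t"
    using assms T_carrier[of t] by (simp add: inv_twist_inject)
  then have "rep g0 = t"
    using g0 assms T_carrier conj_by_eq_iff by (intro rep_eqI) auto
  then show ?thesis
    by (simp add: rho_term_def g0_def)
qed

lemma rho_arrow:
  assumes "t \<in> T" "set gs \<subseteq> carrier G"
  shows "rho G T x (arrow (conj_by t) gs) = grp_tuple G (walk t gs)"
proof (cases "\<one> \<in> set gs")
  case True
  then show ?thesis
    using assms by (simp add: rho_eq arrow_degenerate grp_tuple_degenerate walk_degenerate)
next
  case False
  then show ?thesis
    using assms by (simp add: rho_eq arrow_def hoch_tuple_def rho_term_arrow)
qed

lemma arrow_nondegenerate: "\<one> \<notin> set gs \<Longrightarrow> arrow u gs = bas (inv_twist G gs u, gs)"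
  by (simp add: arrow_def hoch_tuple_def)

lemma rho_closed:
  assumes "p \<in> class_chains G x n"
  shows "rho G T x p \<in> grp_chains C n"
  using assms unfolding rho_eq grp_chains_def class_chains_eq
  by (rule lin_ext_in_free_on)
     (erule class_tuplesE, use walk_in_H in \<open>simp add: rho_term_arrow
       grp_tuple_in_chains[unfolded grp_chains_def]\<close>)

lemma rho_iota:
  fixes p :: "_ \<Rightarrow>\<^sub>0 'k::field"
  assumes "p \<in> grp_chains C n"
  shows "rho G T x (iota G x p) = p"
proof -
  have "rho G T x (arrow x w) = (bas w :: _ \<Rightarrow>\<^sub>0 'k)" if "w \<in> nontriv_tuples C n" for w
  proof -
    have w: "set w \<subseteq> carrier G" "walk \<one> w = w" "\<one> \<notin> set w"
      using nontriv_centralizerD[OF that] H_carrier walk_one[of w] by auto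
    show ?thesis
      using rho_arrow[OF one_rep w(1)] w by (simp add: grp_tuple_def)
  qed
  then have "rho G T x (iota G x p) = lin_ext bas p"
    using assms unfolding rho_eq iota_eq grp_chains_def lin_ext_comp
    by (auto intro: lin_ext_cong_on)
  then show ?thesis
    by (simp add: lin_ext_bas_id)
qed

lemma hoch_boundary_arrow_rep:
  assumes "t \<in> T" "set (g # gs) \<subseteq> carrier G"
  shows "hoch_boundary G (arrow (conj_by t) (g # gs))
     = arrow (conj_by (rep (t \<otimes> g))) gs + lin_ext (arrow (conj_by t)) (bar_tail G (g # gs))"
  using assms T_carrier[of t] hoch_boundary_arrow_Cons[of "conj_by t" g gs]
  by (simp add: conj_by_rep conj_by_mult del: bar_tail.simps)

lemma rho_boundary:
  fixes p :: "_ \<Rightarrow>\<^sub>0 'k::field"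
  assumes "p \<in> class_chains G x n"
  shows "rho G T x (hoch_boundary G p) = grp_boundary C (rho G T x p)"
proof -
  have "rho G T x (hoch_boundary G (bas v)) = grp_boundary C (rho G T x (bas v :: _ \<Rightarrow>\<^sub>0 'k))"
    if "v \<in> class_tuples n" for v
    using that
  proof (rule class_tuplesE)
    fix t gs
    assume t: "t \<in> T" and gs: "set gs \<subseteq> carrier G" and nondeg: "\<one> \<notin> set gs"
      and v: "v = (inv_twist G gs (conj_by t), gs)"
    have bas_v: "bas v = (arrow (conj_by t) gs :: _ \<Rightarrow>\<^sub>0 'k)"
      using nondeg by (simp add: v arrow_nondegenerate)
    show ?thesis
    proof (cases gs)
      case Nil
      then show ?thesis
        unfolding bas_v using t
        by (simp add: hoch_boundary_arrow_Nil grp_boundary_grp_tuple_Nil rho_arrow)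
           (simp add: rho_eq)
    next
      case (Cons g w)
      have t': "rep (t \<otimes> g) \<in> T" and w: "set w \<subseteq> carrier G"
        using t gs T_carrier rep_in_T by (auto simp: Cons)
      have "rho G T x (lin_ext (arrow (conj_by t)) (bar_tail G gs))
          = lin_ext (\<lambda>w. grp_tuple G (walk t w) :: _ \<Rightarrow>\<^sub>0 'k) (bar_tail G gs)"
        unfolding rho_eq lin_ext_comp
        using bar_tail_closed[OF gs]
        by (rule lin_ext_cong_on) (simp add: rho_arrow[OF t, unfolded rho_eq])
      also have "\<dots> = lin_ext (grp_tuple G) (bar_tail G (walk t gs))"
        using t gs by (simp add: bar_tail_walk lin_ext_comp)
      finally have "rho G T x (hoch_boundary G (bas v :: _ \<Rightarrow>\<^sub>0 'k))
          = grp_tuple G (walk (rep (t \<otimes> g)) w) + lin_ext (grp_tuple G) (bar_tail G (walk t gs))"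
        unfolding bas_v using gs
        by (simp add: Cons hoch_boundary_arrow_rep[OF t] rho_arrow[OF t' w, unfolded rho_eq]
            rho_eq lin_ext_add del: bar_tail.simps)
      also have "\<dots> = grp_boundary C (grp_tuple G (walk t gs))"
        using walk_in_H[OF t gs]
        by (simp add: Cons walk_Cons grp_boundary_grp_tuple_Cons del: bar_tail.simps)
      finally show ?thesis
        unfolding bas_v by (simp add: rho_arrow[OF t gs])
    qed
  qed
  then show ?thesis
    using assms unfolding class_chains_eq
    by (auto simp: rho_eq hoch_boundary_eq grp_boundary_def lin_ext_comp intro!: lin_ext_cong_on)
qed

text \<open>
  The chain homotopy from \<open>\<iota> \<circ> \<rho>\<close> to the identity: recover from a tuple the representative \<open>t\<close> of its
  starting vertex, and take the prism over the path, whose paths all start at \<open>x\<close>.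
\<close>

definition deform_term :: "'a \<times> 'a list \<Rightarrow> ('a \<times> 'a list \<Rightarrow>\<^sub>0 'k::field)" where
  "deform_term = (\<lambda>(a, gs).
     lin_ext (arrow x) (prism (THE t. t \<in> T \<and> a = inv_twist G gs (conj_by t)) gs))"

abbreviation deform :: "('a \<times> 'a list \<Rightarrow>\<^sub>0 'k) \<Rightarrow> ('a \<times> 'a list \<Rightarrow>\<^sub>0 'k::field)" where
  "deform \<equiv> lin_ext deform_term"

lemma conj_by_inj_on_T: "t \<in> T \<Longrightarrow> t' \<in> T \<Longrightarrow> conj_by t = conj_by t' \<Longrightarrow> t = t'"
  using conj_by_eq_iff[of t t'] rep_eqI[of t' t] rep_T[of t] T_carrier by auto

lemma deform_term_arrow:
  assumes "t \<in> T" "set gs \<subseteq> carrier G"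
  shows "deform_term (inv_twist G gs (conj_by t), gs) = lin_ext (arrow x) (prism t gs)"
proof -
  have "(THE t'. t' \<in> T \<and> inv_twist G gs (conj_by t) = inv_twist G gs (conj_by t')) = t"
    using assms T_carrier conj_by_inj_on_T by (intro the_equality) (auto simp: inv_twist_inject)
  then show ?thesis
    by (simp add: deform_term_def)
qed

lemma deform_arrow:
  assumes "t \<in> T" "set gs \<subseteq> carrier G"
  shows "deform (arrow (conj_by t) gs) = lin_ext (arrow x) (prism t gs)"
proof (cases "\<one> \<in> set gs")
  case True
  then show ?thesis
    using assms by (simp add: arrow_degenerate prism_degenerate)
next
  case False
  then show ?thesis
    using assms by (simp add: arrow_nondegenerate deform_term_arrow)
qed

lemma deform_closed:
  fixes p :: "_ \<Rightarrow>\<^sub>0 'k::field"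
  assumes "p \<in> class_chains G x n"
  shows "deform p \<in> class_chains G x (Suc n)"
  using assms unfolding class_chains_eq
proof (rule lin_ext_in_free_on)
  fix v assume "v \<in> class_tuples n"
  then obtain t gs where v: "t \<in> T" "set gs \<subseteq> carrier G" "length gs = n"
    "v = (inv_twist G gs (conj_by t), gs)"
    by (rule class_tuplesE)
  have "(lin_ext (arrow x) (prism t gs) :: _ \<Rightarrow>\<^sub>0 'k) \<in> free_on (class_tuples (Suc n))"
    using prism_closed[OF v(1,2)]
    by (rule lin_ext_in_free_on)
       (use v conj_by_in_class[of \<one>] in \<open>auto intro!: arrow_in_class_chains[unfolded class_chains_eq]\<close>)
  then show "(deform_term v :: _ \<Rightarrow>\<^sub>0 'k) \<in> free_on (class_tuples (Suc n))"
    using v by (simp add: deform_term_arrow)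
qed

text \<open>
  Dropping the first arrow of the summand that crosses at once returns the original path; dropping the first
  step of the walk, which is a loop at \<open>x\<close>, turns the other summands into the prism over the shorter path.
\<close>

lemma first_faces_prism:
  assumes "t \<in> T" "set gs \<subseteq> carrier G"
  shows "lin_ext (\<lambda>w. arrow (conj_by (hd w)) (tl w)) (prism t gs)
    = arrow (conj_by t) gs
      - (if gs = [] then 0 else lin_ext (arrow x) (prism (rep (t \<otimes> hd gs)) (tl gs)))"
proof (cases gs)
  case (Cons g w)
  have "conj_by (cocycle t g) = x"
    using assms cocycle_in_H[of t g] centralizer_iff by (simp add: Cons)
  then show ?thesis
    by (simp add: Cons lin_ext_linear lin_ext_push)
qed simp

text \<open>
  The zeroth faces contribute the identity and the faces of positive index contribute \<open>- \<iota> \<circ> \<rho>\<close>.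
\<close>

lemma deform_homotopy:
  fixes p :: "_ \<Rightarrow>\<^sub>0 'k::field"
  assumes "p \<in> class_chains G x n"
  shows "hoch_boundary G (deform p) + deform (hoch_boundary G p) = p - iota G x (rho G T x p)"
proof -
  have "hoch_boundary G (deform_term v) + deform (hoch_boundary G (bas v :: _ \<Rightarrow>\<^sub>0 'k))
      = bas v - iota G x (rho_term v)" if "v \<in> class_tuples n" for v
    using that
  proof (rule class_tuplesE)
    fix t gs
    assume t: "t \<in> T" and gs: "set gs \<subseteq> carrier G" and nondeg: "\<one> \<notin> set gs"
      and v: "v = (inv_twist G gs (conj_by t), gs)"
    have bas_v: "bas v = (arrow (conj_by t) gs :: _ \<Rightarrow>\<^sub>0 'k)"
      using nondeg by (simp add: v arrow_nondegenerate)
    \<comment> \<open>The prism over the path without its first arrow; it occurs with opposite signs in the two terms of the homotopy.\<close>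
    let ?rest = "if gs = [] then 0 else lin_ext (arrow x) (prism (rep (t \<otimes> hd gs)) (tl gs))"
    have "hoch_boundary G (deform_term v :: _ \<Rightarrow>\<^sub>0 'k)
        = lin_ext (\<lambda>w. hoch_boundary G (arrow x w)) (prism t gs)"
      by (simp add: v deform_term_arrow[OF t gs] hoch_boundary_eq lin_ext_comp)
    also have "\<dots> = lin_ext (\<lambda>w. arrow (conj_by (hd w)) (tl w) + lin_ext (arrow x) (bar_tail G w))
        (prism t gs)"
      using prism_closed[OF t gs]
    proof (rule lin_ext_cong_on)
      fix w assume "w \<in> {w. set w \<subseteq> carrier G \<and> length w = Suc (length gs)}"
      then show "hoch_boundary G (arrow x w)
          = arrow (conj_by (hd w)) (tl w) + lin_ext (arrow x) (bar_tail G w :: _ \<Rightarrow>\<^sub>0 'k)"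
        by (cases w) (simp_all add: hoch_boundary_arrow_Cons conj_by_def del: bar_tail.simps)
    qed
    also have "\<dots> = arrow (conj_by t) gs - ?rest
        + lin_ext (arrow x) (lin_ext (bar_tail G) (prism t gs))"
      by (simp add: lin_ext_plus_fun first_faces_prism[OF t gs] lin_ext_comp)
    finally have left: "hoch_boundary G (deform_term v)
      = arrow (conj_by t) gs - ?rest + lin_ext (arrow x) (lin_ext (bar_tail G) (prism t gs) :: _ \<Rightarrow>\<^sub>0 'k)" .
    have right: "deform (hoch_boundary G (bas v :: _ \<Rightarrow>\<^sub>0 'k))
        = ?rest + lin_ext (arrow x) (lin_ext (prism t) (bar_tail G gs))"
    proof (cases gs)
      case Nil
      then show ?thesis
        unfolding bas_v by (simp add: hoch_boundary_arrow_Nil)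
    next
      case (Cons g w)
      have t': "rep (t \<otimes> g) \<in> T" and w: "set w \<subseteq> carrier G"
        using t gs T_carrier rep_in_T by (auto simp: Cons)
      have "deform (lin_ext (arrow (conj_by t)) (bar_tail G gs))
          = lin_ext (arrow x) (lin_ext (prism t) (bar_tail G gs) :: _ \<Rightarrow>\<^sub>0 'k)"
        unfolding lin_ext_comp using bar_tail_closed[OF gs]
        by (rule lin_ext_cong_on) (simp add: deform_arrow[OF t])
      then show ?thesis
        unfolding bas_v using gs
        by (simp add: Cons hoch_boundary_arrow_rep[OF t] deform_arrow[OF t' w] lin_ext_add del: bar_tail.simps)
    qed
    have "hoch_boundary G (deform_term v) + deform (hoch_boundary G (bas v :: _ \<Rightarrow>\<^sub>0 'k))
        = arrow (conj_by t) gs + lin_ext (arrow x)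
            (lin_ext (bar_tail G) (prism t gs) + lin_ext (prism t) (bar_tail G gs))"
      unfolding left right by (simp add: lin_ext_add)
    also have "\<dots> = bas v - iota G x (rho_term v)"
      unfolding bas_v
      by (simp add: prism_homotopy[OF t gs] lin_ext_minus v rho_term_arrow[OF t gs] iota_grp_tuple)
    finally show ?thesis .
  qed
  then have "lin_ext (\<lambda>v. hoch_boundary G (deform_term v) + deform (hoch_boundary G (bas v))) p
      = lin_ext (\<lambda>v. bas v - iota G x (rho_term v)) p"
    using assms unfolding class_chains_eq by (auto intro: lin_ext_cong_on)
  then show ?thesis
    by (simp add: lin_ext_plus_fun lin_ext_diff_fun lin_ext_bas_id hoch_boundary_eq iota_eq rho_eq
        lin_ext_comp)
qed

subsection \<open>The Connes operator on the summand\<close>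

text \<open>
  Rotating a word by one place conjugates its product by the first letter.
\<close>

lemma word_prod_rotate_in_class:
  assumes "set w \<subseteq> carrier G" "word_prod w \<in> conj_class G x"
  shows "word_prod (rotate j w) \<in> conj_class G x"
proof (induction j)
  case (Suc j)
  have "set (rotate j w) \<subseteq> carrier G"
    using assms by simp
  then show ?case
  proof (cases "rotate j w")
    case (Cons a v)
    have av: "a \<in> carrier G" "set v \<subseteq> carrier G"
      using \<open>set (rotate j w) \<subseteq> carrier G\<close> by (auto simp: Cons)
    then have "word_prod (rotate (Suc j) w) = inv a \<otimes> word_prod (rotate j w) \<otimes> a"
      by (simp add: Cons word_prod_append m_assoc[symmetric])
    then show ?thesis
      using Suc av by (simp add: conj_class_conjugate)
  qed (use Suc in simp)
qed (use assms in simp)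

text \<open>
  The tuple \<open>(1, w)\<close> is a path that starts at the product of \<open>w\<close>. For the rotations of a tuple
  of the summand this product is conjugate to \<open>x\<close>.
\<close>

lemma connes_closed:
  fixes p :: "_ \<Rightarrow>\<^sub>0 'k::field"
  assumes "p \<in> class_chains G x n"
  shows "connes G p \<in> class_chains G x (Suc n)"
  using assms unfolding class_chains_eq connes_eq
proof (rule lin_ext_in_free_on)
  fix v assume "v \<in> class_tuples n"
  then obtain t gs where t: "t \<in> T" "set gs \<subseteq> carrier G" "length gs = n"
    and v: "v = (inv_twist G gs (conj_by t), gs)"
    by (rule class_tuplesE)
  let ?a = "inv_twist G gs (conj_by t)" let ?u = "conj_by t"
  have a: "?a \<in> carrier G" "?u \<in> conj_class G x" "?u \<in> carrier G"
    using t T_carrier inv_twist_closed conj_by_in_class by auto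
  have "word_prod (?a # gs) = ?a \<otimes> (word_prod gs \<otimes> ?a) \<otimes> inv ?a"
    using a t by (simp add: m_assoc)
  also have "word_prod gs \<otimes> ?a = ?u"
    using a t by (simp add: word_prod_inv_twist)
  finally have cl: "word_prod (?a # gs) \<in> conj_class G x"
    using conj_class_conjugate[OF a(2), of "inv ?a"] a by simp
  have unit_tuple_in: "(unit_tuple (rotate j (?a # gs)) :: _ \<Rightarrow>\<^sub>0 'k) \<in> free_on (class_tuples (Suc n))" for j
  proof -
    let ?w = "rotate j (?a # gs)"
    have w: "set ?w \<subseteq> carrier G" "length ?w = Suc n"
      using a t by auto
    have "inv_twist G ?w (word_prod ?w) = \<one>"
      using w by (simp add: inv_twist_eq)
    then have "unit_tuple ?w = (arrow (word_prod ?w) ?w :: _ \<Rightarrow>\<^sub>0 'k)"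
      by (simp add: unit_tuple_def arrow_def)
    then show ?thesis
      using arrow_in_class_chains[OF word_prod_rotate_in_class[OF _ cl] w] a t
      by (simp add: class_chains_eq)
  qed
  then show "(connes_term v :: _ \<Rightarrow>\<^sub>0 'k) \<in> free_on (class_tuples (Suc n))"
    unfolding v connes_term_eq cyc_norm_def sgn_rot_def lin_ext_linear lin_ext_bas
    by (intro free_on_sum free_on_scale)
qed

end

section \<open>Homology classes and induced maps\<close>

locale chain_complex =
  fixes C :: "nat \<Rightarrow> 'c::ab_group_add set" and d :: "'c \<Rightarrow> 'c"
  assumes C_zero: "0 \<in> C n"
    and C_diff: "z \<in> C n \<Longrightarrow> w \<in> C n \<Longrightarrow> z - w \<in> C n"
    and d_diff: "d (z - w) = d z - d w"
begin

lemma boundaries_diff: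
  assumes "z \<in> boundaries C d n" "w \<in> boundaries C d n"
  shows "z - w \<in> boundaries C d n"
  using assms C_diff by (auto simp: boundaries_def d_diff[symmetric] image_iff)

lemma boundaries_zero: "0 \<in> boundaries C d n"
  using C_zero[of "Suc n"] d_diff[of 0 0] by (force simp: boundaries_def)

lemma homologous_equiv: "equiv (cycles C d n) (homologous C d n)"
proof (rule equivI)
  show "refl_on (cycles C d n) (homologous C d n)"
    by (auto simp: refl_on_def homologous_def boundaries_zero)
  show "sym (homologous C d n)"
    using boundaries_diff[OF boundaries_zero] by (force simp: sym_def homologous_def)
  show "trans (homologous C d n)"
  proof (rule transI)
    fix u v w assume "(u, v) \<in> homologous C d n" "(v, w) \<in> homologous C d n"
    then have uvw: "u \<in> cycles C d n" "w \<in> cycles C d n"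
      and "u - v \<in> boundaries C d n" "v - w \<in> boundaries C d n"
      by (auto simp: homologous_def)
    then have "(u - v) - (0 - (v - w)) \<in> boundaries C d n"
      using boundaries_diff boundaries_zero by blast
    with uvw show "(u, w) \<in> homologous C d n"
      by (auto simp: homologous_def)
  qed
qed (auto simp: homologous_def)

lemma hclass_eq_iff:
  "z \<in> cycles C d n \<Longrightarrow> w \<in> cycles C d n \<Longrightarrow>
     hclass C d n z = hclass C d n w \<longleftrightarrow> z - w \<in> boundaries C d n"
  using eq_equiv_class_iff[OF homologous_equiv] by (auto simp: hclass_def homologous_def)

lemma hclass_in_homology: "z \<in> cycles C d n \<Longrightarrow> hclass C d n z \<in> homology C d n"
  by (auto simp: hclass_def homology_def intro: quotientI)

lemma homologyE:
  assumes "c \<in> homology C d n"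
  obtains z where "z \<in> cycles C d n" "c = hclass C d n z"
  using assms by (auto simp: homology_def hclass_def elim: quotientE)

end

text \<open>
  The union in \<open>hmap\<close> runs over all cycles in the class; an additive map that respects cycles and boundaries
  sends them to one and the same class.
\<close>

lemma hmap_hclass:
  assumes "chain_complex C d" "chain_complex C' d'" "z \<in> cycles C d n"
    and "\<And>w. w \<in> cycles C d n \<Longrightarrow> f w \<in> cycles C' d' m"
    and "\<And>b. b \<in> C (Suc n) \<Longrightarrow> f (d b) \<in> boundaries C' d' m"
    and "\<And>v w. f (v - w) = f v - f w"
  shows "hmap C' d' m f (hclass C d n z) = hclass C' d' m (f z)"
proof -
  interpret C: chain_complex C d by fact
  interpret C': chain_complex C' d' by fact
  have "hclass C' d' m (f w) = hclass C' d' m (f z)" if "w \<in> hclass C d n z" for w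
  proof -
    have w: "w \<in> cycles C d n" "z - w \<in> boundaries C d n"
      using that by (auto simp: hclass_def homologous_def)
    then obtain b where "b \<in> C (Suc n)" "z - w = d b"
      by (auto simp: boundaries_def)
    then have "f z - f w \<in> boundaries C' d' m"
      using assms(5)[of b] assms(6)[of z w] by simp
    then show ?thesis
      using C'.hclass_eq_iff assms(3,4) w by metis
  qed
  moreover have "z \<in> hclass C d n z"
    using assms(3) C.boundaries_zero by (auto simp: hclass_def homologous_def)
  ultimately show ?thesis
    unfolding hmap_def by blast
qed

lemma chain_complex_free_on: "chain_complex (\<lambda>n. free_on (S n)) (lin_ext f)"
  by standard (simp_all add: free_on_zero free_on_diff lin_ext_diff)

context centralizer_transversal begin

lemma chain_complex_class: "chain_complex (class_chains G x) (hoch_boundary G)"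
  and chain_complex_hoch: "chain_complex (hoch_chains G) (hoch_boundary G)"
  and chain_complex_grp: "chain_complex (grp_chains C) (grp_boundary C)"
  unfolding class_chains_eq[abs_def] hoch_chains_def[abs_def] grp_chains_def[abs_def]
    hoch_boundary_eq grp_boundary_def
  by (rule chain_complex_free_on)+

abbreviation class_of_grp :: "nat \<Rightarrow> ('a list \<Rightarrow>\<^sub>0 'k::field) \<Rightarrow> ('a list \<Rightarrow>\<^sub>0 'k) set" where
  "class_of_grp \<equiv> hclass (grp_chains C) (grp_boundary C)"

abbreviation class_of_class ::
    "nat \<Rightarrow> ('a \<times> 'a list \<Rightarrow>\<^sub>0 'k::field) \<Rightarrow> ('a \<times> 'a list \<Rightarrow>\<^sub>0 'k) set" where
  "class_of_class \<equiv> hclass (class_chains G x) (hoch_boundary G)"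

abbreviation class_of_hoch ::
    "nat \<Rightarrow> ('a \<times> 'a list \<Rightarrow>\<^sub>0 'k::field) \<Rightarrow> ('a \<times> 'a list \<Rightarrow>\<^sub>0 'k) set" where
  "class_of_hoch \<equiv> hclass (hoch_chains G) (hoch_boundary G)"

abbreviation grp_cycles :: "nat \<Rightarrow> ('a list \<Rightarrow>\<^sub>0 'k::field) set" where
  "grp_cycles \<equiv> cycles (grp_chains C) (grp_boundary C)"

abbreviation class_cycles :: "nat \<Rightarrow> ('a \<times> 'a list \<Rightarrow>\<^sub>0 'k::field) set" where
  "class_cycles \<equiv> cycles (class_chains G x) (hoch_boundary G)"

lemma iota_zero: "iota G x 0 = 0" and rho_zero: "rho G T x 0 = 0"
  and connes_zero: "connes G 0 = 0"
  by (simp_all add: iota_eq rho_eq connes_eq)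

lemma iota_cycles: "z \<in> grp_cycles n \<Longrightarrow> iota G x z \<in> class_cycles n"
  by (auto simp: cycles_def iota_closed iota_boundary iota_zero)

lemma rho_cycles: "z \<in> class_cycles n \<Longrightarrow> rho G T x z \<in> grp_cycles n"
  by (auto simp: cycles_def rho_closed rho_boundary[symmetric] rho_zero)

lemma hoch_boundary_connes_class:
  "p \<in> class_chains G x n \<Longrightarrow> hoch_boundary G (connes G p) = - connes G (hoch_boundary G p)"
  by (rule hoch_boundary_connes[OF subsetD[OF class_chains_subset]])

lemma connes_cycles: "z \<in> class_cycles n \<Longrightarrow> connes G z \<in> class_cycles (Suc n)"
  by (auto simp: cycles_def connes_closed hoch_boundary_connes_class connes_zero)

lemma class_cycles_subset: "class_cycles n \<subseteq> cycles (hoch_chains G) (hoch_boundary G) n"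
  using class_chains_subset by (auto simp: cycles_def)

lemma hoch_boundary_minus: "hoch_boundary G (- p) = - hoch_boundary G p"
  by (simp add: hoch_boundary_eq lin_ext_minus)

lemma connes_boundaries:
  assumes "b \<in> class_chains G x (Suc n)"
  shows "connes G (hoch_boundary G b) \<in> boundaries (class_chains G x) (hoch_boundary G) (Suc n)"
proof -
  have "connes G (hoch_boundary G b) = hoch_boundary G (- connes G b)"
    using assms by (simp add: hoch_boundary_minus hoch_boundary_connes_class)
  moreover have "- connes G b \<in> class_chains G x (Suc (Suc n))"
    using connes_closed[OF assms] by (simp add: class_chains_eq free_on_minus)
  ultimately show ?thesis
    by (auto simp: boundaries_def)
qed

lemma rho_hclass:
  assumes "z \<in> class_cycles n"
  shows "rho_homology G T x n (class_of_class n z) = class_of_grp n (rho G T x z)"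
  unfolding rho_homology_def
  by (rule hmap_hclass[OF chain_complex_class chain_complex_grp assms])
     (auto simp: rho_cycles boundaries_def rho_boundary rho_closed, simp add: rho_eq lin_ext_diff)

lemma connes_hclass:
  assumes "z \<in> class_cycles n"
  shows "connes_class G x n (class_of_class n z) = class_of_class (Suc n) (connes G z)"
  unfolding connes_class_def
  by (rule hmap_hclass[OF chain_complex_class chain_complex_class assms])
     (auto simp: connes_cycles connes_boundaries, simp add: connes_eq lin_ext_diff)

lemma connes_hoch_chains:
  assumes "p \<in> hoch_chains G n"
  shows "connes G p \<in> hoch_chains G (Suc n)"
  using assms unfolding hoch_chains_def connes_eq
proof (rule lin_ext_in_free_on)
  fix v assume "v \<in> carrier G \<times> nontriv_tuples G n"
  then obtain a gs where v: "v = (a, gs)" "a \<in> carrier G" "set gs \<subseteq> carrier G" "length gs = n"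
    by (auto simp: nontriv_tuples_def)
  have unit: "(unit_tuple w :: _ \<Rightarrow>\<^sub>0 'b) \<in> free_on (carrier G \<times> nontriv_tuples G (Suc n))"
    if "set w \<subseteq> carrier G" "length w = Suc n" for w
    using that unfolding unit_tuple_def hoch_tuple_def
    by (auto simp: nontriv_tuples_def intro!: free_on_zero free_on_bas)
  show "(connes_term v :: _ \<Rightarrow>\<^sub>0 'b) \<in> free_on (carrier G \<times> nontriv_tuples G (Suc n))"
    unfolding v connes_term_eq cyc_norm_def sgn_rot_def lin_ext_linear lin_ext_bas
    by (intro free_on_sum free_on_scale unit) (use v in auto)
qed

lemma connes_hclass_hoch:
  assumes "z \<in> class_cycles n"
  shows "connes_HH G n (class_of_hoch n z) = class_of_hoch (Suc n) (connes G z)"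
  unfolding connes_HH_def
proof (rule hmap_hclass[OF chain_complex_hoch chain_complex_hoch])
  show "z \<in> cycles (hoch_chains G) (hoch_boundary G) n"
    using assms class_cycles_subset by blast
next
  fix w :: "'a \<times> 'a list \<Rightarrow>\<^sub>0 'b"
  assume "w \<in> cycles (hoch_chains G) (hoch_boundary G) n"
  then show "connes G w \<in> cycles (hoch_chains G) (hoch_boundary G) (Suc n)"
    by (auto simp: cycles_def connes_hoch_chains hoch_boundary_connes connes_zero)
next
  fix b :: "'a \<times> 'a list \<Rightarrow>\<^sub>0 'b"
  assume b: "b \<in> hoch_chains G (Suc n)"
  have "connes G (hoch_boundary G b) = hoch_boundary G (- connes G b)"
    using b by (simp add: hoch_boundary_minus hoch_boundary_connes)
  moreover have "- connes G b \<in> hoch_chains G (Suc (Suc n))"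
    using connes_hoch_chains[OF b] by (simp add: hoch_chains_def free_on_minus)
  ultimately show "connes G (hoch_boundary G b) \<in> boundaries (hoch_chains G) (hoch_boundary G) (Suc n)"
    by (auto simp: boundaries_def)
qed (simp add: connes_eq lin_ext_diff)

lemma summand_embedding_hclass:
  assumes "z \<in> grp_cycles n"
  shows "summand_embedding G x n (class_of_grp n z) = class_of_hoch n (iota G x z)"
  unfolding summand_embedding_def
proof (rule hmap_hclass[OF chain_complex_grp chain_complex_hoch assms])
  fix b :: "'a list \<Rightarrow>\<^sub>0 'b" assume "b \<in> grp_chains C (Suc n)"
  then show "iota G x (grp_boundary C b) \<in> boundaries (hoch_chains G) (hoch_boundary G) n"
    using iota_closed class_chains_subset iota_boundary unfolding boundaries_def
    by (metis image_eqI subsetD)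
qed (use iota_cycles class_cycles_subset in auto, simp add: iota_eq lin_ext_diff)

text \<open>
  On a cycle the homotopy identity has only one term on the left.
\<close>

lemma iota_rho_homologous:
  assumes "z \<in> class_cycles n"
  shows "z - iota G x (rho G T x z) \<in> boundaries (class_chains G x) (hoch_boundary G) n"
proof -
  have z: "z \<in> class_chains G x n" "hoch_boundary G z = 0"
    using assms by (auto simp: cycles_def)
  have "z - iota G x (rho G T x z) = hoch_boundary G (deform z)"
    using deform_homotopy[OF z(1)] z(2) by simp
  then show ?thesis
    using deform_closed[OF z(1)] by (simp add: boundaries_def)
qed

text \<open>
  The map induced by \<open>\<rho>\<close> has the map induced by \<open>\<iota>\<close> as a left inverse, since \<open>\<iota> \<circ> \<rho>\<close> is homologous to the
  identity on cycles, so it is injective; as \<open>\<rho> \<circ> \<iota>\<close> is the identity, the class of \<open>\<iota> z\<close> is the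
  preimage of the class of \<open>z\<close>.
\<close>

lemma rho_homology_inverse:
  fixes z :: "'a list \<Rightarrow>\<^sub>0 'k::field"
  assumes "z \<in> grp_cycles n"
  shows "inv_into (H_class G x n) (rho_homology G T x n) (class_of_grp n z) = class_of_class n (iota G x z)"
proof -
  interpret Cl: chain_complex "class_chains G x" "hoch_boundary G" by (rule chain_complex_class)
  interpret Gr: chain_complex "grp_chains C" "grp_boundary C" by (rule chain_complex_grp)
  have inj: "inj_on (rho_homology G T x n) (H_class G x n :: ('a \<times> 'a list \<Rightarrow>\<^sub>0 'k) set set)"
  proof (rule inj_on_inverseI)
    fix c :: "('a \<times> 'a list \<Rightarrow>\<^sub>0 'k) set"
    assume "c \<in> H_class G x n"
    then obtain w where w: "w \<in> class_cycles n" "c = class_of_class n w"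
      by (rule Cl.homologyE)
    have "hmap (class_chains G x) (hoch_boundary G) n (iota G x) (class_of_grp n (rho G T x w))
        = class_of_class n (iota G x (rho G T x w))"
    proof (rule hmap_hclass[OF chain_complex_grp chain_complex_class rho_cycles[OF w(1)]])
      fix b :: "'a list \<Rightarrow>\<^sub>0 'k" assume b: "b \<in> grp_chains C (Suc n)"
      show "iota G x (grp_boundary C b) \<in> boundaries (class_chains G x) (hoch_boundary G) n"
        unfolding iota_boundary[OF b, symmetric] boundaries_def using iota_closed[OF b] by blast
    qed (use iota_cycles in auto, simp add: iota_eq lin_ext_diff)
    moreover have "class_of_class n w = class_of_class n (iota G x (rho G T x w))"
      using w(1) iota_rho_homologous[OF w(1)]
      by (subst Cl.hclass_eq_iff) (auto intro: iota_cycles rho_cycles)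
    ultimately show "hmap (class_chains G x) (hoch_boundary G) n (iota G x) (rho_homology G T x n c) = c"
      unfolding w(2) rho_hclass[OF w(1)] by simp
  qed
  have "rho_homology G T x n (class_of_class n (iota G x z)) = class_of_grp n z"
    using assms rho_hclass[OF iota_cycles[OF assms]] rho_iota[of z n] by (simp add: cycles_def)
  then show ?thesis
    using inv_into_f_f[OF inj Cl.hclass_in_homology[OF iota_cycles[OF assms]]] by simp
qed

lemma Btilde_hclass:
  assumes "z \<in> grp_cycles s"
  shows "Btilde G T x s (class_of_grp s z) = class_of_grp (Suc s) (Btilde_chain G T x z)"
  using assms by (simp add: Btilde_def rho_homology_inverse connes_hclass rho_hclass
      iota_cycles connes_cycles Btilde_chain_def)

lemma Btilde_chain_cycles: "z \<in> grp_cycles s \<Longrightarrow> Btilde_chain G T x z \<in> grp_cycles (Suc s)"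
  by (simp add: Btilde_chain_def iota_cycles connes_cycles rho_cycles)

text \<open>
  The two sides are the classes of \<open>B (\<iota> z)\<close> and \<open>\<iota> (\<rho> (B (\<iota> z)))\<close>. These cycles of the summand differ by
  a boundary of the summand, which is also a boundary of the full Hochschild complex.
\<close>

lemma Btilde_compatible:
  assumes "z \<in> grp_cycles s"
  shows "connes_HH G s (summand_embedding G x s (class_of_grp s z))
     = summand_embedding G x (Suc s) (Btilde G T x s (class_of_grp s z))"
proof -
  interpret Cl: chain_complex "class_chains G x" "hoch_boundary G" by (rule chain_complex_class)
  interpret Ho: chain_complex "hoch_chains G" "hoch_boundary G" by (rule chain_complex_hoch)
  let ?b = "connes G (iota G x z)"
  have b: "?b \<in> class_cycles (Suc s)" "iota G x (rho G T x ?b) \<in> class_cycles (Suc s)"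
    using assms by (simp_all add: iota_cycles connes_cycles rho_cycles)
  have "?b - iota G x (rho G T x ?b) \<in> boundaries (hoch_chains G) (hoch_boundary G) (Suc s)"
    using iota_rho_homologous[OF b(1)] class_chains_subset by (auto simp: boundaries_def)
  then have "class_of_hoch (Suc s) ?b = class_of_hoch (Suc s) (iota G x (rho G T x ?b))"
    using b class_cycles_subset by (subst Ho.hclass_eq_iff) auto
  moreover have "summand_embedding G x (Suc s) (Btilde G T x s (class_of_grp s z))
      = class_of_hoch (Suc s) (iota G x (rho G T x ?b))"
    using assms by (simp add: Btilde_hclass summand_embedding_hclass Btilde_chain_cycles)
      (simp add: Btilde_chain_def)
  ultimately show ?thesis
    using assms by (simp add: summand_embedding_hclass connes_hclass_hoch iota_cycles)
qed

subsection \<open>The formula\<close>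

text \<open>
  The path \<open>w\<close> starts at \<open>x\<close> and consists of loops; the walk from the representative \<open>1\<close> reproduces it. This is
  where \<open>1 \<in> T\<close> enters the formula.
\<close>

lemma rho_unit_tuple:
  assumes "set w \<subseteq> centralizer G x" "word_prod w = x"
  shows "rho G T x (unit_tuple w) = grp_tuple G w"
proof -
  have w: "set w \<subseteq> carrier G"
    using assms H_carrier by auto
  then have "inv_twist G w x = \<one>"
    using assms by (simp add: inv_twist_eq)
  then show ?thesis
    using rho_arrow[OF one_rep w] walk_one[OF assms(1)] by (simp add: unit_tuple_def arrow_def)
qed

text \<open>
  The product of \<open>(h\<^sub>s\<inverse> \<cdots> h\<^sub>1\<inverse> x, h\<^sub>1, \<dots>, h\<^sub>s)\<close> is a conjugate of \<open>x\<close> by an element of the centralizer, hence \<open>x\<close>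
  itself, and rotations conjugate it by further elements of the centralizer. So \<open>\<rho>\<close> strips the
  coefficient \<open>1\<close> from every summand of the Connes operator.
\<close>

lemma Btilde_chain_bas:
  assumes hs: "hs \<in> nontriv_tuples C s"
  shows "Btilde_chain G T x (bas hs :: _ \<Rightarrow>\<^sub>0 'k::field)
     = grp_tuple C (inv_twist G hs x # hs)
       + (\<Sum>i=1..s. scale ((-1) ^ (i * s))
           (grp_tuple C (drop (i - 1) hs @ [inv_twist G hs x] @ take (i - 1) hs)))"
proof -
  let ?a = "inv_twist G hs x"
  have h: "set hs \<subseteq> centralizer G x" "\<one> \<notin> set hs" "length hs = s"
    using nontriv_centralizerD[OF hs] by auto
  then have hc: "set hs \<subseteq> carrier G"
    using H_carrier by auto
  have p: "word_prod hs \<in> centralizer G x"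
    using h(1) subgroup.m_closed[OF subgroup_H] subgroup.one_closed[OF subgroup_H]
    by (induction hs) auto
  have x: "x \<in> centralizer G x"
    by (simp add: centralizer_def)
  have a: "?a \<in> centralizer G x"
    using p x subgroup_H hc by (simp add: inv_twist_eq subgroup.m_closed subgroup.m_inv_closed)
  have "?a \<otimes> word_prod hs = inv (word_prod hs) \<otimes> x \<otimes> word_prod hs"
    using hc by (simp add: inv_twist_eq)
  then have prod: "word_prod (?a # hs) = x"
    using p centralizer_iff[of "word_prod hs"] by (simp add: conj_by_def)
  have rot: "rho G T x (unit_tuple (rotate j (?a # hs))) = (grp_tuple G (rotate j (?a # hs)) :: _ \<Rightarrow>\<^sub>0 'k)"
    for j
  proof (rule rho_unit_tuple)
    show "set (rotate j (?a # hs)) \<subseteq> centralizer G x"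
      using a h by simp
    show "word_prod (rotate j (?a # hs)) = x"
    proof (induction j)
      case (Suc j)
      let ?w = "rotate j (?a # hs)"
      obtain b v where w: "?w = b # v"
        by (cases ?w) auto
      have "set ?w \<subseteq> centralizer G x"
        using a h by simp
      then have bv: "b \<in> centralizer G x" "b \<in> carrier G" "set v \<subseteq> carrier G"
        using H_carrier by (auto simp: w)
      then have "word_prod (rotate (Suc j) (?a # hs)) = inv b \<otimes> word_prod ?w \<otimes> b"
        by (simp add: w word_prod_append m_assoc[symmetric])
      also have "\<dots> = x"
        using bv Suc.IH centralizer_iff[of b] by (simp add: conj_by_def)
      finally show ?case .
    qed (use prod in simp)
  qed
  have "Btilde_chain G T x (bas hs :: _ \<Rightarrow>\<^sub>0 'k) = rho G T x (connes_term (?a, hs))"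
    using h by (simp add: Btilde_chain_def iota_eq arrow_nondegenerate connes_eq)
  also have "\<dots> = (\<Sum>j<Suc s. scale ((-1) ^ (j * s)) (grp_tuple G (rotate j (?a # hs))))"
    using h by (simp add: connes_term_eq cyc_norm_def sgn_rot_def lin_ext_linear rho_eq rot[unfolded rho_eq]
        del: rotate_Suc)
  also have "{..<Suc s} = insert 0 {1..s}"
    by auto
  also have "(\<Sum>j\<in>insert 0 {1..s}. scale ((-1) ^ (j * s)) (grp_tuple G (rotate j (?a # hs)) :: _ \<Rightarrow>\<^sub>0 'k))
      = grp_tuple G (?a # hs) + (\<Sum>i=1..s. scale ((-1) ^ (i * s)) (grp_tuple G (rotate i (?a # hs))))"
    by simp
  also have "(\<Sum>i=1..s. scale ((-1) ^ (i * s)) (grp_tuple G (rotate i (?a # hs)) :: _ \<Rightarrow>\<^sub>0 'k))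
      = (\<Sum>i=1..s. scale ((-1) ^ (i * s))
           (grp_tuple G (drop (i - 1) hs @ [?a] @ take (i - 1) hs) :: _ \<Rightarrow>\<^sub>0 'k))"
    using h by (intro sum.cong refl) (auto simp: rotate_drop_take drop_Cons' take_Cons')
  finally show ?thesis
    by (simp add: centralizer_group_simps)
qed

lemma Btilde_chain_closed:
  assumes "p \<in> grp_chains C s"
  shows "Btilde_chain G T x p \<in> grp_chains C (Suc s)"
  using assms by (simp add: Btilde_chain_def iota_closed connes_closed rho_closed)

end

theorem theorem6p4:
  fixes G :: "('a, 'm) monoid_scheme" and X T :: "'a set" and x :: 'a and s :: nat
  assumes "group G" and "finite (carrier G)"
    and "conj_class_reps G X" and "x \<in> X"
    and "right_coset_reps G (centralizer G x) T" and "\<one>\<^bsub>G\<^esub> \<in> T"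
  shows
    "Btilde G T x s \<in> (H_cent G x s :: ('a list \<Rightarrow>\<^sub>0 'k::field) set set) \<rightarrow> H_cent G x (s + 1)
     \<and> (\<forall>c \<in> (H_cent G x s :: ('a list \<Rightarrow>\<^sub>0 'k) set set).
          connes_HH G s (summand_embedding G x s c)
            = summand_embedding G x (s + 1) (Btilde G T x s c))
     \<and> (let C = centralizer_group G x in
          (\<forall>z :: 'a list \<Rightarrow>\<^sub>0 'k. z \<in> cycles (grp_chains C) (grp_boundary C) s \<longrightarrow>
             Btilde G T x s (hclass (grp_chains C) (grp_boundary C) s z)
               = hclass (grp_chains C) (grp_boundary C) (s + 1) (Btilde_chain G T x z))
        \<and> (\<forall>hs \<in> nontriv_tuples C s.
             Btilde_chain G T x (Poly_Mapping.single hs (1 :: 'k))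
               = grp_tuple C (inv_twist G hs x # hs)
                 + (\<Sum>i=1..s. scale ((-1) ^ (i * s))
                     (grp_tuple C (drop (i - 1) hs @ [inv_twist G hs x] @ take (i - 1) hs)))
           \<and> Btilde_chain G T x (Poly_Mapping.single hs (1 :: 'k)) \<in> grp_chains C (s + 1)))"
proof -
  interpret group G by fact
  have "x \<in> carrier G"
    using assms by (auto simp: conj_class_reps_def)
  then interpret centralizer_transversal G x T
    using assms by unfold_locales
  interpret Gr: chain_complex "grp_chains C" "grp_boundary C" by (rule chain_complex_grp)
  have "Btilde G T x s c \<in> H_cent G x (s + 1)
      \<and> connes_HH G s (summand_embedding G x s c) = summand_embedding G x (s + 1) (Btilde G T x s c)"
    if "c \<in> H_cent G x s" for c :: "('a list \<Rightarrow>\<^sub>0 'k) set"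
    using that
  proof (rule Gr.homologyE)
    fix z assume z: "z \<in> grp_cycles s" "c = class_of_grp s z"
    then show ?thesis
      using Gr.hclass_in_homology[OF Btilde_chain_cycles[OF z(1)]]
      by (simp add: Btilde_compatible) (simp add: Btilde_hclass)
  qed
  moreover have "Btilde_chain G T x (bas hs :: 'a list \<Rightarrow>\<^sub>0 'k) \<in> grp_chains C (s + 1)"
    if "hs \<in> nontriv_tuples C s" for hs
    using that by (auto intro!: Btilde_chain_closed free_on_bas simp: grp_chains_def[of _ s])
  ultimately show ?thesis
    unfolding Let_def by (auto simp: Btilde_hclass Btilde_chain_bas)
qed

end
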